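(* Let $d,n\ge1$ and let $f$ be holomorphic in a neighborhood of the closed ball $\overline{\mathbb{B}}_d$. Then $$\|f\|_{\mathrm{Mult}(H^2_d),n}=\sup\{\|f(T)\| : T\in\overline{\mathfrak{C}\mathfrak{B}_d(n)} \text{ diagonalizable}\}.$$
   Context: $\mathbb{B}_d$ is the open Euclidean unit ball of $\mathbb{C}^d$. $H^2_d$ is the Drury--Arveson space, the reproducing kernel Hilbert space on $\mathbb{B}_d$ with kernel $k(z,w)=\frac{1}{1-\langle z,w\rangle}$. For a reproducing kernel Hilbert space $\mathcal{H}$ on $\mathbb{B}_d$ and $F\subset\mathbb{B}_d$, $\mathcal{H}|_F$ is the reproducing kernel Hilbert space on $F$ whose kernel is the restriction of the kernel of $\mathcal{H}$ to $F\times F$; $\|g\|_{\mathrm{Mult}(\mathcal{H})}$ is the norm of the operator of multiplication by $g$ on $\mathcal{H}$. The $n$-point multiplier norm of $f:\mathbb{B}_d\to\mathbb{C}$ is $$\|f\|_{\mathrm{Mult}(\mathcal{H}),n}=\sup\{\|f|_F\|_{\mathrm{Mult}(\mathcal{H}|_F)}: F\subset\mathbb{B}_d,\ |F|\le n\}.$$ $\overline{\mathfrak{C}\mathfrak{B}_d(n)}$ is the set of all $d$-tuples $T=(T_1,\ldots,T_d)$ of commuting $n\times n$ complex matrices with $\|\sum_i T_iT_i^*\|^{1/2}\le1$. Diagonalizable means jointly diagonalizable: there is an invertible $S$ with $T_i=SD_iS^{-1}$, $D_i$ diagonal; in that case, if $\lambda_j\in\mathbb{C}^d$ denotes the tuple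 of $j$-th diagonal entries of $(D_1,\dots,D_d)$ (these points lie in $\overline{\mathbb{B}}_d$), then $f(T)=S\,\mathrm{diag}(f(\lambda_1),\ldots,f(\lambda_n))S^{-1}$. *)

theory Defs
  imports "HOL-Analysis.Analysis"
begin

section \<open>Holomorphic functions of several complex variables\<close>

text \<open>The library notion \<open>holomorphic_on\<close> is restricted to functions of one variable.  On an open
  set, a function of several variables is holomorphic iff its Frechet derivative exists everywhere
  and is complex linear.\<close>

definition holomorphic_several :: "(complex ^ 'd \<Rightarrow> complex) \<Rightarrow> (complex ^ 'd) set \<Rightarrow> bool"
  where "holomorphic_several f U \<longleftrightarrow>
    (\<forall>z\<in>U. \<exists>D. (f has_derivative D) (at z) \<and> Vector_Spaces.linear (*s) (*) D)"


section \<open>Reproducing kernel Hilbert spaces and multiplier norms\<close>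

text \<open>A function on \<open>X\<close> is represented by its extension by \<open>0\<close> to the whole type.\<close>

definition kernel_fun :: "'a set \<Rightarrow> ('a \<Rightarrow> 'a \<Rightarrow> complex) \<Rightarrow> 'a \<Rightarrow> 'a \<Rightarrow> complex"
  where "kernel_fun X K w = (\<lambda>z. if z \<in> X then K z w else 0)"

definition hnorm :: "(('a \<Rightarrow> complex) \<Rightarrow> ('a \<Rightarrow> complex) \<Rightarrow> complex) \<Rightarrow> ('a \<Rightarrow> complex) \<Rightarrow> real"
  where "hnorm ip h = sqrt (Re (ip h h))"

text \<open>The inner product is linear in its first argument.  Its values outside \<open>H\<close> are set to \<open>0\<close>,
  so that the pair \<open>(H, ip)\<close> is uniquely determined by \<open>X\<close> and \<open>K\<close>.\<close>

locale reproducing_kernel_Hilbert_space =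
  fixes X :: "'a set"
    and K :: "'a \<Rightarrow> 'a \<Rightarrow> complex"
    and H :: "('a \<Rightarrow> complex) set"
    and ip :: "('a \<Rightarrow> complex) \<Rightarrow> ('a \<Rightarrow> complex) \<Rightarrow> complex"
  assumes supported: "h \<in> H \<Longrightarrow> z \<notin> X \<Longrightarrow> h z = 0"
    and zero_mem: "(\<lambda>z. 0) \<in> H"
    and add_mem: "g \<in> H \<Longrightarrow> h \<in> H \<Longrightarrow> (\<lambda>z. g z + h z) \<in> H"
    and scale_mem: "h \<in> H \<Longrightarrow> (\<lambda>z. c * h z) \<in> H"
    and ip_outside: "g \<notin> H \<or> h \<notin> H \<Longrightarrow> ip g h = 0"
    and ip_add: "g \<in> H \<Longrightarrow> g' \<in> H \<Longrightarrow> h \<in> H \<Longrightarrow>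
      ip (\<lambda>z. g z + g' z) h = ip g h + ip g' h"
    and ip_scale: "g \<in> H \<Longrightarrow> h \<in> H \<Longrightarrow> ip (\<lambda>z. c * g z) h = c * ip g h"
    and ip_commute: "g \<in> H \<Longrightarrow> h \<in> H \<Longrightarrow> ip h g = cnj (ip g h)"
    and ip_positive: "h \<in> H \<Longrightarrow> h \<noteq> (\<lambda>z. 0) \<Longrightarrow> Re (ip h h) > 0"
    and complete: "range u \<subseteq> H \<Longrightarrow>
      (\<And>e. e > 0 \<Longrightarrow> \<exists>N. \<forall>i\<ge>N. \<forall>j\<ge>N. hnorm ip (\<lambda>z. u i z - u j z) < e) \<Longrightarrow>
      \<exists>h\<in>H. (\<lambda>i::nat. hnorm ip (\<lambda>z. u i z - h z)) \<longlonglongrightarrow> 0"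
    and kernel_mem: "w \<in> X \<Longrightarrow> kernel_fun X K w \<in> H"
    and reproducing: "h \<in> H \<Longrightarrow> w \<in> X \<Longrightarrow> ip h (kernel_fun X K w) = h w"

text \<open>For positive semidefinite \<open>K\<close> the space exists and is unique (Moore--Aronszajn).  Since
  only values of \<open>K\<close> on \<open>X \<times> X\<close> matter, \<open>rkhs F K\<close> for \<open>F \<subseteq> X\<close> is the restriction to \<open>F\<close> of the
  space with kernel \<open>K\<close> on \<open>X\<close>.\<close>

definition rkhs :: "'a set \<Rightarrow> ('a \<Rightarrow> 'a \<Rightarrow> complex) \<Rightarrow>
    ('a \<Rightarrow> complex) set \<times> (('a \<Rightarrow> complex) \<Rightarrow> ('a \<Rightarrow> complex) \<Rightarrow> complex)"
  where "rkhs X K = (THE (H, ip). reproducing_kernel_Hilbert_space X K H ip)"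

text \<open>The norm is extended real valued: it is \<open>\<infinity>\<close> if \<open>g\<close> is not a multiplier.\<close>

definition mult_norm :: "'a set \<Rightarrow> ('a \<Rightarrow> 'a \<Rightarrow> complex) \<Rightarrow> ('a \<Rightarrow> complex) \<Rightarrow> ereal"
  where "mult_norm X K g =
    (case rkhs X K of (H, ip) \<Rightarrow>
      if \<forall>h\<in>H. (\<lambda>z. g z * h z) \<in> H
      then (SUP h\<in>{h \<in> H. hnorm ip h \<le> 1}. ereal (hnorm ip (\<lambda>z. g z * h z)))
      else \<infinity>)"

definition mult_norm_points ::
    "'a set \<Rightarrow> ('a \<Rightarrow> 'a \<Rightarrow> complex) \<Rightarrow> nat \<Rightarrow> ('a \<Rightarrow> complex) \<Rightarrow> ereal"
  where "mult_norm_points X K n f =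
    (SUP F\<in>{F. F \<subseteq> X \<and> finite F \<and> card F \<le> n}. mult_norm F K f)"

definition drury_arveson_kernel :: "complex ^ 'd \<Rightarrow> complex ^ 'd \<Rightarrow> complex"
  where "drury_arveson_kernel z w = 1 / (1 - (\<Sum>i\<in>UNIV. z $ i * cnj (w $ i)))"


section \<open>Commuting row contractions\<close>

definition conj_transpose :: "complex ^ 'n ^ 'm \<Rightarrow> complex ^ 'm ^ 'n"
  where "conj_transpose A = (\<chi> i j. cnj (A $ j $ i))"

definition op_norm :: "complex ^ 'n ^ 'm \<Rightarrow> real"
  where "op_norm A = onorm (\<lambda>x. A *v x)"

definition diag_matrix :: "complex ^ 'n \<Rightarrow> complex ^ 'n ^ 'n"
  where "diag_matrix v = (\<chi> i j. if i = j then v $ i else 0)"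

definition commuting_row_contractions :: "('d::finite \<Rightarrow> complex ^ 'n ^ 'n) set"
  where "commuting_row_contractions =
    {T. (\<forall>i j. T i ** T j = T j ** T i) \<and>
        sqrt (op_norm (\<Sum>i\<in>UNIV. T i ** conj_transpose (T i))) \<le> 1}"

text \<open>\<open>L $ j\<close> is the point of \<open>\<complex>\<^sup>d\<close> formed by the \<open>j\<close>-th diagonal entries.\<close>

definition diagonalizes ::
    "complex ^ 'n ^ 'n \<Rightarrow> complex ^ 'd ^ 'n \<Rightarrow> ('d \<Rightarrow> complex ^ 'n ^ 'n) \<Rightarrow> bool"
  where "diagonalizes S L T \<longleftrightarrow> invertible S \<and>
    (\<forall>i. T i = S ** diag_matrix (\<chi> j. L $ j $ i) ** matrix_inv S)"

definition jointly_diagonalizable :: "('d::finite \<Rightarrow> complex ^ 'n ^ 'n) \<Rightarrow> bool"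
  where "jointly_diagonalizable T \<longleftrightarrow> (\<exists>S L. diagonalizes S L T)"

text \<open>The result does not depend on the choice of the diagonalization.\<close>

definition apply_tuple ::
    "(complex ^ 'd \<Rightarrow> complex) \<Rightarrow> ('d::finite \<Rightarrow> complex ^ 'n ^ 'n) \<Rightarrow> complex ^ 'n ^ 'n"
  where "apply_tuple f T =
    (THE A. \<exists>S L. diagonalizes S L T \<and>
      A = S ** diag_matrix (\<chi> j. f (L $ j)) ** matrix_inv S)"

end

theory Submission
  imports Defs
begin

text \<open>Everything reduces to positivity of Hermitian forms over a finite set of points.

  For a finite \<open>F\<close> on which the kernel \<open>K\<close> is positive definite, the adjoint of multiplication by
  \<open>g\<close> sends the kernel function at \<open>w\<close> to \<open>cnj (g w)\<close> times itself.  Hence the multiplier norm of \<open>g\<close>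
  on \<open>F\<close> is at most \<open>C\<close> iff the matrix \<open>(C\<^sup>2 - g z * cnj (g w)) * K z w\<close> is positive semidefinite on
  \<open>F\<close> (\<open>mult_norm_finite_le_iff\<close>).

  A diagonalizable tuple \<open>T\<close> with \<open>T i = S D\<^sub>i S\<inverse>\<close> behaves in the same way: the columns
  \<open>v\<^sub>j\<close> of the conjugate transpose of \<open>S\<inverse>\<close> are joint eigenvectors of the adjoints of the \<open>T i\<close>, with
  the conjugates of the coordinates of \<open>\<lambda>\<^sub>j\<close> as eigenvalues.  With \<open>G\<close> the Gram matrix of
  the \<open>v\<^sub>j\<close>, the tuple is a row contraction iff \<open>(1 - \<langle>\<lambda>\<^sub>j, \<lambda>\<^sub>k\<rangle>) * G j k\<close>
  is positive semidefinite, and \<open>f(T)\<close> has norm at most \<open>C\<close> iff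
  \<open>(C\<^sup>2 - f \<lambda>\<^sub>j * cnj (f \<lambda>\<^sub>k)) * G j k\<close> is (\<open>row_contraction_spectral_iff\<close>,
  \<open>op_norm_spectral_le_iff\<close>).

  The Drury--Arveson kernel \<open>K\<close> is the entrywise inverse of \<open>1 - \<langle>z, w\<rangle>\<close>, which links the two
  sides.  Given a row contraction with \<open>\<lambda>\<^sub>j\<close> in the open ball, the entrywise product of the two
  positive semidefinite matrices \<open>(1 - \<langle>\<lambda>\<^sub>j, \<lambda>\<^sub>k\<rangle>) * G j k\<close> and
  \<open>(C\<^sup>2 - f \<lambda>\<^sub>j * cnj (f \<lambda>\<^sub>k)) * K \<lambda>\<^sub>j \<lambda>\<^sub>k\<close> is
  \<open>(C\<^sup>2 - f \<lambda>\<^sub>j * cnj (f \<lambda>\<^sub>k)) * G j k\<close>, so Schur's product theorem bounds \<open>f(T)\<close>;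
  points on the sphere are reached as limits of \<open>r \<lambda>\<^sub>j\<close> with \<open>r < 1\<close>, by continuity of \<open>f\<close>
  (\<open>norm_apply_tuple_le_mult_norm_points\<close>).  Conversely, every set of at most \<open>n\<close> points
  lies in a set of exactly \<open>n\<close> points of the ball.  Its kernel matrix is positive definite, hence is
  the Gram matrix \<open>G\<close> of a diagonalizing \<open>S\<close> by Cholesky factorization, and the tuple obtained from \<open>S\<close>
  is a row contraction because \<open>(1 - \<langle>\<lambda>\<^sub>j, \<lambda>\<^sub>k\<rangle>) * G j k = 1\<close>
  (\<open>mult_norm_finite_le_norm_apply_tuple\<close>).\<close>

section \<open>Positive semidefinite forms on finite sets\<close>

definition quadratic_form :: "'a set \<Rightarrow> ('a \<Rightarrow> 'a \<Rightarrow> complex) \<Rightarrow> ('a \<Rightarrow> complex) \<Rightarrow> complex"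
  where "quadratic_form A P c = (\<Sum>z\<in>A. \<Sum>w\<in>A. cnj (c z) * P z w * c w)"

definition psd :: "'a set \<Rightarrow> ('a \<Rightarrow> 'a \<Rightarrow> complex) \<Rightarrow> bool"
  where "psd A P \<longleftrightarrow> (\<forall>z\<in>A. \<forall>w\<in>A. P w z = cnj (P z w)) \<and>
    (\<forall>c. 0 \<le> Re (quadratic_form A P c))"

lemma psd_hermitian: "psd A P \<Longrightarrow> z \<in> A \<Longrightarrow> w \<in> A \<Longrightarrow> P w z = cnj (P z w)"
  unfolding psd_def by blast

lemma psd_nonneg: "psd A P \<Longrightarrow> 0 \<le> Re (quadratic_form A P c)"
  unfolding psd_def by blast

lemma quadratic_form_cong:
  "(\<And>z w. z \<in> A \<Longrightarrow> w \<in> A \<Longrightarrow> P z w = Q z w) \<Longrightarrow> (\<And>z. z \<in> A \<Longrightarrow> c z = d z) \<Longrightarrow>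
    quadratic_form A P c = quadratic_form A Q d"
  unfolding quadratic_form_def by (auto intro!: sum.cong)

lemma quadratic_form_mono_neutral:
  assumes "finite B" "A \<subseteq> B" "\<And>z. z \<in> B - A \<Longrightarrow> c z = 0"
  shows "quadratic_form B P c = quadratic_form A P c"
proof -
  have "quadratic_form B P c = (\<Sum>z\<in>A. \<Sum>w\<in>B. cnj (c z) * P z w * c w)"
    unfolding quadratic_form_def using assms by (intro sum.mono_neutral_right) auto
  also have "\<dots> = quadratic_form A P c"
    unfolding quadratic_form_def using assms by (intro sum.cong sum.mono_neutral_right) auto
  finally show ?thesis .
qed

lemma psd_subset:
  assumes "psd B P" "finite B" "A \<subseteq> B"
  shows "psd A P"
proof -
  have "0 \<le> Re (quadratic_form A P c)" for c
  proof -
    let ?d = "\<lambda>z. if z \<in> A then c z else 0"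
    have "quadratic_form B P ?d = quadratic_form A P ?d"
      using assms by (intro quadratic_form_mono_neutral) auto
    also have "\<dots> = quadratic_form A P c"
      by (rule quadratic_form_cong) auto
    finally show ?thesis using psd_nonneg[OF assms(1), of ?d] by (simp only:)
  qed
  then show ?thesis using assms unfolding psd_def by blast
qed

lemma psd_diagonal_nonneg:
  assumes "psd A P" "finite A" "a \<in> A"
  shows "0 \<le> Re (P a a)"
proof -
  have "psd {a} P" using psd_subset[OF assms(1,2)] assms(3) by auto
  from psd_nonneg[OF this, of "\<lambda>_. 1"] show ?thesis by (simp add: quadratic_form_def)
qed

text \<open>Points of \<open>A\<close> may be identified by \<open>\<phi>\<close>: the form at \<open>c\<close> is the form on the image at the
  coefficients that add up \<open>c\<close> over each fibre.\<close>

lemma psd_pullback: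
  assumes "psd (\<phi> ` A) P" "finite A"
  shows "psd A (\<lambda>j k. P (\<phi> j) (\<phi> k))"
proof -
  have "0 \<le> Re (quadratic_form A (\<lambda>j k. P (\<phi> j) (\<phi> k)) c)" for c
  proof -
    let ?d = "\<lambda>z. \<Sum>j\<in>{j\<in>A. \<phi> j = z}. c j"
    have "quadratic_form (\<phi> ` A) P ?d = (\<Sum>z\<in>\<phi> ` A. \<Sum>w\<in>\<phi> ` A.
        \<Sum>j\<in>{j\<in>A. \<phi> j = z}. \<Sum>k\<in>{k\<in>A. \<phi> k = w}. cnj (c j) * P (\<phi> j) (\<phi> k) * c k)"
      unfolding quadratic_form_def
      by (intro sum.cong refl) (simp add: sum_distrib_left sum_distrib_right, rule sum.swap)
    also have "\<dots> = (\<Sum>z\<in>\<phi> ` A. \<Sum>j\<in>{j\<in>A. \<phi> j = z}. \<Sum>w\<in>\<phi> ` A.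
        \<Sum>k\<in>{k\<in>A. \<phi> k = w}. cnj (c j) * P (\<phi> j) (\<phi> k) * c k)"
      by (intro sum.cong refl) (rule sum.swap)
    also have "\<dots> = (\<Sum>z\<in>\<phi> ` A. \<Sum>j\<in>{j\<in>A. \<phi> j = z}. \<Sum>k\<in>A. cnj (c j) * P (\<phi> j) (\<phi> k) * c k)"
      using assms(2) by (intro sum.cong refl) (rule sum.image_gen[symmetric])
    also have "\<dots> = quadratic_form A (\<lambda>j k. P (\<phi> j) (\<phi> k)) c"
      unfolding quadratic_form_def using assms(2) by (intro sum.image_gen[symmetric])
    finally show ?thesis using psd_nonneg[OF assms(1), of ?d] by (simp only:)
  qed
  then show ?thesis using assms unfolding psd_def by blast
qed

lemma psd_image:
  assumes "psd A (\<lambda>j k. P (\<phi> j) (\<phi> k))" "inj_on \<phi> A"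
  shows "psd (\<phi> ` A) P"
proof -
  have "quadratic_form (\<phi> ` A) P c = quadratic_form A (\<lambda>j k. P (\<phi> j) (\<phi> k)) (c \<circ> \<phi>)" for c
    unfolding quadratic_form_def using assms(2) by (simp add: sum.reindex)
  then have "0 \<le> Re (quadratic_form (\<phi> ` A) P c)" for c
    using psd_nonneg[OF assms(1)] by (simp only:)
  then show ?thesis using assms(1) unfolding psd_def by blast
qed

lemma quadratic_form_linear:
  "quadratic_form A (\<lambda>z w. a * P z w + b * Q z w) c = a * quadratic_form A P c + b * quadratic_form A Q c"
  unfolding quadratic_form_def sum_distrib_left sum.distrib[symmetric]
  by (intro sum.cong refl) (simp add: algebra_simps)

lemma psd_add_scale:
  assumes "psd A P" "psd A Q" "0 \<le> s" "0 \<le> t"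
  shows "psd A (\<lambda>z w. of_real s * P z w + of_real t * Q z w)"
proof -
  have "0 \<le> Re (quadratic_form A (\<lambda>z w. of_real s * P z w + of_real t * Q z w) c)" for c
    unfolding quadratic_form_linear using assms(3,4) psd_nonneg[OF assms(1), of c] psd_nonneg[OF assms(2), of c] by simp
  moreover have "of_real s * P w z + of_real t * Q w z = cnj (of_real s * P z w + of_real t * Q z w)"
    if "z \<in> A" "w \<in> A" for z w
    using psd_hermitian[OF assms(1) that] psd_hermitian[OF assms(2) that] by simp
  ultimately show ?thesis unfolding psd_def by blast
qed

lemma quadratic_form_insert:
  assumes "finite A" "a \<notin> A"
  shows "quadratic_form (insert a A) P c = cnj (c a) * P a a * c a
    + cnj (c a) * (\<Sum>w\<in>A. P a w * c w) + (\<Sum>z\<in>A. cnj (c z) * P z a) * c a + quadratic_form A P c"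
  using assms unfolding quadratic_form_def
  by (simp add: sum.distrib sum_distrib_left sum_distrib_right mult.assoc add.assoc)

text \<open>With \<open>P a a = 0\<close> the form at the coefficients \<open>- t * P a w\<close> at \<open>a\<close> and \<open>1\<close> at \<open>w\<close> is affine in the
  real number \<open>t\<close>, so it stays nonnegative only if its slope, a multiple of \<open>(cmod (P a w))\<^sup>2\<close>, is \<open>0\<close>.\<close>

lemma psd_pivot_zero:
  assumes "finite A" "a \<notin> A" "psd (insert a A) P" "P a a = 0" "w \<in> A"
  shows "P a w = 0"
proof -
  let ?c = "\<lambda>t z. if z = a then - of_real t * P a w else if z = w then 1 else 0"
  have h: "P w a = cnj (P a w)"
    using assms(5) by (intro psd_hermitian[OF assms(3)]) auto
  have wa: "w \<noteq> a" using assms by auto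
  have "Re (quadratic_form (insert a A) P (?c t)) = Re (P w w) - 2 * t * (cmod (P a w))\<^sup>2" for t :: real
  proof -
    have "quadratic_form (insert a A) P (?c t) = quadratic_form {a, w} P (?c t)"
      using assms by (intro quadratic_form_mono_neutral) auto
    also have "\<dots> = P w w - 2 * of_real t * (P a w * cnj (P a w))"
      using wa h assms(4) unfolding quadratic_form_def by (simp add: algebra_simps)
    also have "\<dots> = P w w - of_real (2 * t * (cmod (P a w))\<^sup>2)"
      by (simp add: complex_norm_square[symmetric])
    finally show ?thesis by (simp del: of_real_mult)
  qed
  then have *: "0 \<le> Re (P w w) - 2 * t * (cmod (P a w))\<^sup>2" for t
    using psd_nonneg[OF assms(3), of "?c t"] by (simp only:)
  show ?thesis
  proof (rule ccontr)
    assume "P a w \<noteq> 0"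
    then have "(cmod (P a w))\<^sup>2 > 0" by simp
    \<comment> \<open>This \<open>t\<close> makes the affine function equal to \<open>- 1\<close>.\<close>
    then show False using *[of "(Re (P w w) + 1) / (2 * (cmod (P a w))\<^sup>2)"] by (simp add: field_simps)
  qed
qed

text \<open>The form of the Schur complement at \<open>c\<close> is the minimum of the form of \<open>P\<close> over all choices of the
  coefficient at \<open>a\<close>.  If \<open>P a a = 0\<close>, the quotient is \<open>0\<close> and the complement is \<open>P\<close> itself.\<close>

lemma psd_schur_complement:
  assumes "finite A" "a \<notin> A" "psd (insert a A) P"
  shows "psd A (\<lambda>z w. P z w - P z a * P a w / P a a)"
proof (cases "P a a = 0")
  case True
  then show ?thesis using psd_subset[OF assms(3), of A] assms(1) by auto
next
  case False
  have h: "P w z = cnj (P z w)" if "z \<in> insert a A" "w \<in> insert a A" for z w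
    using psd_hermitian[OF assms(3) that] .
  have "0 \<le> Re (quadratic_form A (\<lambda>z w. P z w - P z a * P a w / P a a) c)" for c
  proof -
    define X where "X = (\<Sum>w\<in>A. P a w * c w)"
    \<comment> \<open>The coefficient at \<open>a\<close> that minimizes the form.\<close>
    let ?d = "c(a := - X / P a a)"
    have X': "(\<Sum>z\<in>A. cnj (c z) * P z a) = cnj X"
      unfolding X_def cnj_sum by (intro sum.cong refl) (simp add: h[of a])
    have XX: "cnj X * X = quadratic_form A (\<lambda>z w. P z a * P a w) c"
      unfolding X'[symmetric] unfolding X_def sum_product quadratic_form_def by (simp add: mult.assoc)
    have paa: "cnj (P a a) = P a a" using h[of a a] by simp
    have "quadratic_form A P ?d = quadratic_form A P c" using assms by (intro quadratic_form_cong) auto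
    moreover have "(\<Sum>w\<in>A. P a w * ?d w) = X" "(\<Sum>z\<in>A. cnj (?d z) * P z a) = cnj X"
      unfolding X'[symmetric] using assms by (auto simp: X_def intro!: sum.cong)
    ultimately have "quadratic_form (insert a A) P ?d = quadratic_form A P c - cnj X * X / P a a"
      using False assms by (simp add: quadratic_form_insert paa field_simps)
    also have "\<dots> = quadratic_form A (\<lambda>z w. 1 * P z w + (- 1 / P a a) * (P z a * P a w)) c"
      unfolding quadratic_form_linear XX[symmetric] by simp
    also have "\<dots> = quadratic_form A (\<lambda>z w. P z w - P z a * P a w / P a a) c"
      by (intro quadratic_form_cong) (auto simp: field_simps)
    finally show ?thesis using psd_nonneg[OF assms(3), of ?d] by (simp only:)
  qed
  moreover have "P w z - P w a * P a z / P a a = cnj (P z w - P z a * P a w / P a a)"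
    if "z \<in> A" "w \<in> A" for z w
    using h[of z w] h[of a w] h[of z a] h[of a a] that by (simp add: mult.commute)
  ultimately show ?thesis unfolding psd_def by blast
qed

text \<open>Cholesky factorization, by elimination of one point after the other.  The index set of the factor is
  \<open>A\<close> itself, so that for \<open>A = UNIV\<close> the factor is a square matrix.\<close>

lemma psd_factorization:
  assumes "finite A" "psd A P"
  shows "\<exists>V. \<forall>z\<in>A. \<forall>w\<in>A. P z w = (\<Sum>l\<in>A. cnj (V l z) * V l w)"
  using assms
proof (induction A arbitrary: P rule: finite_induct)
  case empty
  then show ?case by simp
next
  case (insert a A)
  have h: "P w z = cnj (P z w)" if "z \<in> insert a A" "w \<in> insert a A" for z w
    using psd_hermitian[OF insert.prems that] .
  obtain V where V: "\<And>z w. z \<in> A \<Longrightarrow> w \<in> A \<Longrightarrow>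
      P z w - P z a * P a w / P a a = (\<Sum>l\<in>A. cnj (V l z) * V l w)"
    using insert.IH[OF psd_schur_complement[OF insert.hyps insert.prems]] by blast
  define p where "p = Re (P a a)"
  have paa: "P a a = of_real p" using h[of a a] by (simp add: p_def complex_eq_iff)
  have p0: "p \<ge> 0"
    unfolding p_def by (rule psd_diagonal_nonneg[OF insert.prems]) (use insert.hyps in auto)
  \<comment> \<open>If \<open>p = 0\<close>, the new row is \<open>0\<close>, in agreement with \<open>P a w = 0\<close>.\<close>
  define W where "W l w = (if l = a then P a w / of_real (sqrt p) else if w = a then 0 else V l w)" for l w
  have s: "complex_of_real (sqrt p) * of_real (sqrt p) = of_real p"
    using p0 by (simp flip: of_real_mult)
  have z0: "P a w = 0" if "p = 0" "w \<in> A" for w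
    using psd_pivot_zero[OF insert.hyps insert.prems] that paa by auto
  have row: "cnj (W a z) * W a w = P z a * P a w / of_real p" if "z \<in> insert a A" for z w
    using h[of a z] that s by (simp add: W_def)
  have "P z w = (\<Sum>l\<in>insert a A. cnj (W l z) * W l w)" if zw: "z \<in> insert a A" "w \<in> insert a A" for z w
  proof -
    have "(\<Sum>l\<in>A. cnj (W l z) * W l w) = (if z = a \<or> w = a then 0 else \<Sum>l\<in>A. cnj (V l z) * V l w)"
      using insert.hyps by (auto simp: W_def intro!: sum.cong sum.neutral)
    then have "(\<Sum>l\<in>insert a A. cnj (W l z) * W l w) = P z a * P a w / of_real p
        + (if z = a \<or> w = a then 0 else P z w - P z a * P a w / P a a)"
      using V zw insert.hyps row by auto
    also have "\<dots> = P z w"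
      using z0 paa zw h[of a z] by (cases "p = 0") auto
    finally show ?thesis by simp
  qed
  then show ?case by blast
qed

text \<open>If \<open>P z w\<close> is a sum of products \<open>cnj (V l z) * V l w\<close>, then the form of the entrywise product at
  \<open>c\<close> is the sum over \<open>l\<close> of the forms of \<open>Q\<close> at the coefficients \<open>V l z * c z\<close>.\<close>

lemma psd_schur_product:
  assumes "finite A" "psd A P" "psd A Q"
  shows "psd A (\<lambda>z w. P z w * Q z w)"
proof -
  obtain V where V: "\<And>z w. z \<in> A \<Longrightarrow> w \<in> A \<Longrightarrow> P z w = (\<Sum>l\<in>A. cnj (V l z) * V l w)"
    using psd_factorization[OF assms(1,2)] by blast
  have "0 \<le> Re (quadratic_form A (\<lambda>z w. P z w * Q z w) c)" for c
  proof -
    have "quadratic_form A (\<lambda>z w. P z w * Q z w) c =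
        (\<Sum>z\<in>A. \<Sum>w\<in>A. \<Sum>l\<in>A. cnj (V l z * c z) * Q z w * (V l w * c w))"
      unfolding quadratic_form_def
      by (intro sum.cong refl) (simp add: V sum_distrib_left sum_distrib_right mult_ac)
    also have "\<dots> = (\<Sum>z\<in>A. \<Sum>l\<in>A. \<Sum>w\<in>A. cnj (V l z * c z) * Q z w * (V l w * c w))"
      by (rule sum.cong[OF refl], rule sum.swap)
    also have "\<dots> = (\<Sum>l\<in>A. quadratic_form A Q (\<lambda>z. V l z * c z))"
      unfolding quadratic_form_def by (rule sum.swap)
    finally show ?thesis
      using psd_nonneg[OF assms(3)] by (simp add: Re_sum sum_nonneg)
  qed
  moreover have "P w z * Q w z = cnj (P z w * Q z w)" if "z \<in> A" "w \<in> A" for z w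
    using psd_hermitian[OF assms(2) that] psd_hermitian[OF assms(3) that] by simp
  ultimately show ?thesis unfolding psd_def by blast
qed

section \<open>Positive definite forms\<close>

definition positive_definite :: "'a set \<Rightarrow> ('a \<Rightarrow> 'a \<Rightarrow> complex) \<Rightarrow> bool"
  where "positive_definite A P \<longleftrightarrow> psd A P \<and>
    (\<forall>c. Re (quadratic_form A P c) = 0 \<longrightarrow> (\<forall>z\<in>A. c z = 0))"

lemma positive_definite_null:
  "positive_definite A P \<Longrightarrow> Re (quadratic_form A P c) = 0 \<Longrightarrow> z \<in> A \<Longrightarrow> c z = 0"
  unfolding positive_definite_def by blast

lemma positive_definite_subset:
  assumes "positive_definite B P" "finite B" "A \<subseteq> B"
  shows "positive_definite A P"
proof -
  have "\<forall>z\<in>A. c z = 0" if "Re (quadratic_form A P c) = 0" for c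
  proof -
    let ?d = "\<lambda>z. if z \<in> A then c z else 0"
    have "quadratic_form B P ?d = quadratic_form A P ?d"
      using assms by (intro quadratic_form_mono_neutral) auto
    also have "\<dots> = quadratic_form A P c"
      by (rule quadratic_form_cong) auto
    finally have "Re (quadratic_form B P ?d) = 0"
      using that by (simp only:)
    then have "?d z = 0" if "z \<in> B" for z
      using positive_definite_null[OF assms(1)] that by blast
    then show ?thesis using assms(3) by (metis subset_iff)
  qed
  then show ?thesis
    using assms psd_subset unfolding positive_definite_def by blast
qed

lemma positive_definite_pullback:
  assumes pd: "positive_definite (\<phi> ` A) P" and "finite A" and inj: "inj_on \<phi> A"
  shows "positive_definite A (\<lambda>j k. P (\<phi> j) (\<phi> k))"
proof -
  have "psd (\<phi> ` A) P" using pd unfolding positive_definite_def by blast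
  then have "psd A (\<lambda>j k. P (\<phi> j) (\<phi> k))"
    using assms(2) by (rule psd_pullback)
  moreover have "c j = 0"
    if c: "Re (quadratic_form A (\<lambda>j k. P (\<phi> j) (\<phi> k)) c) = 0" and j: "j \<in> A" for c j
  proof -
    let ?d = "\<lambda>z. c (inv_into A \<phi> z)"
    have "quadratic_form (\<phi> ` A) P ?d = quadratic_form A (\<lambda>j k. P (\<phi> j) (\<phi> k)) c"
      unfolding quadratic_form_def using inj by (simp add: sum.reindex)
    then have "Re (quadratic_form (\<phi> ` A) P ?d) = 0" using c by simp
    from positive_definite_null[OF pd this, of "\<phi> j"] show ?thesis using inj j by simp
  qed
  ultimately show ?thesis unfolding positive_definite_def by blast
qed

lemma quadratic_form_eq_sum:
  "quadratic_form A P c = (\<Sum>z\<in>A. cnj (c z) * (\<Sum>w\<in>A. P z w * c w))"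
  unfolding quadratic_form_def by (simp add: sum_distrib_left mult.assoc)

lemma positive_definite_injective:
  assumes "positive_definite A P" "\<And>z. z \<in> A \<Longrightarrow> (\<Sum>w\<in>A. P z w * c w) = (\<Sum>w\<in>A. P z w * d w)" "z \<in> A"
  shows "c z = d z"
proof -
  have "quadratic_form A P (\<lambda>z. c z - d z) = 0"
    unfolding quadratic_form_eq_sum using assms(2) by (simp add: right_diff_distrib sum_subtractf)
  then have "c z - d z = 0"
    using positive_definite_null[OF assms(1), of "\<lambda>z. c z - d z"] assms(3) by simp
  then show ?thesis by simp
qed

text \<open>Gaussian elimination.  A combination of the columns that vanishes on \<open>A\<close> but has coefficient \<open>1\<close> at
  the new point \<open>a\<close> cannot vanish at \<open>a\<close>, since the form would be \<open>0\<close> there; a multiple of it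
  corrects the value at \<open>a\<close> of a solution on \<open>A\<close>.\<close>

lemma positive_definite_surjective:
  assumes "finite A" "positive_definite A P"
  shows "\<exists>c. \<forall>z\<in>A. (\<Sum>w\<in>A. P z w * c w) = h z"
  using assms
proof (induction A arbitrary: h rule: finite_induct)
  case empty
  then show ?case by simp
next
  case (insert a A)
  have pd: "positive_definite A P"
    using positive_definite_subset[OF insert.prems] insert.hyps by auto
  obtain c0 where c0: "\<forall>z\<in>A. (\<Sum>w\<in>A. P z w * c0 w) = - P z a"
    using insert.IH[OF pd, of "\<lambda>z. - P z a"] by blast
  obtain c1 where c1: "\<forall>z\<in>A. (\<Sum>w\<in>A. P z w * c1 w) = h z"
    using insert.IH[OF pd, of h] by blast
  have upd: "(\<Sum>w\<in>insert a A. P z w * (if w = a then t else c w)) = P z a * t + (\<Sum>w\<in>A. P z w * c w)" for z c t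
  proof -
    have "(\<Sum>w\<in>A. P z w * (if w = a then t else c w)) = (\<Sum>w\<in>A. P z w * c w)"
      using insert.hyps by (intro sum.cong) auto
    then show ?thesis using insert.hyps by simp
  qed
  define s where "s = P a a + (\<Sum>w\<in>A. P a w * c0 w)"
  have "s \<noteq> 0"
  proof
    assume "s = 0"
    then have "quadratic_form (insert a A) P (\<lambda>w. if w = a then 1 else c0 w) = 0"
      unfolding quadratic_form_eq_sum upd using c0 insert.hyps by (simp add: s_def)
    then show False
      using positive_definite_null[OF insert.prems, of "\<lambda>w. if w = a then 1 else c0 w" a] by simp
  qed
  define t where "t = (h a - (\<Sum>w\<in>A. P a w * c1 w)) / s"
  have "(\<Sum>w\<in>insert a A. P z w * (if w = a then t else c1 w + t * c0 w)) = h z" if "z \<in> insert a A" for z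
  proof -
    have "(\<Sum>w\<in>A. P z w * (c1 w + t * c0 w)) = (\<Sum>w\<in>A. P z w * c1 w) + t * (\<Sum>w\<in>A. P z w * c0 w)"
      by (simp add: distrib_left sum.distrib sum_distrib_left mult_ac)
    then have e: "(\<Sum>w\<in>insert a A. P z w * (if w = a then t else c1 w + t * c0 w)) =
        (\<Sum>w\<in>A. P z w * c1 w) + t * (P z a + (\<Sum>w\<in>A. P z w * c0 w))"
      unfolding upd by (simp add: algebra_simps)
    show ?thesis
    proof (cases "z = a")
      case True
      then have "(\<Sum>w\<in>insert a A. P z w * (if w = a then t else c1 w + t * c0 w)) =
        (\<Sum>w\<in>A. P a w * c1 w) + t * s" unfolding e s_def by simp
      then show ?thesis using \<open>s \<noteq> 0\<close> True by (simp add: t_def)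
    next
      case False
      then show ?thesis unfolding e using that c0 c1 by simp
    qed
  qed
  then show ?case
    by (intro exI[of _ "\<lambda>w. if w = a then t else c1 w + t * c0 w"] ballI)
qed

lemma positive_definite_Cauchy_Schwarz:
  assumes "positive_definite A P"
  shows "Re (\<Sum>z\<in>A. cnj (c z) * (\<Sum>w\<in>A. P z w * d w))
    \<le> sqrt (Re (quadratic_form A P c)) * sqrt (Re (quadratic_form A P d))"
proof -
  define S where "S = (\<lambda>c d. \<Sum>z\<in>A. \<Sum>w\<in>A. cnj (c z) * P z w * d w)"
  have S: "(\<Sum>z\<in>A. cnj (c z) * (\<Sum>w\<in>A. P z w * d w)) = S c d" 
    unfolding S_def by (simp add: sum_distrib_left mult.assoc)
  have Q: "quadratic_form A P c = S c c" for c
    unfolding S_def quadratic_form_def ..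
  have psd: "psd A P" using assms unfolding positive_definite_def by blast
  have "S d c = (\<Sum>w\<in>A. \<Sum>z\<in>A. cnj (d z) * P z w * c w)"
    unfolding S_def by (rule sum.swap)
  also have "\<dots> = cnj (S c d)"
    unfolding S_def cnj_sum
    by (intro sum.cong refl) (simp add: psd_hermitian[OF psd, symmetric] mult_ac)
  finally have swap: "Re (S d c) = Re (S c d)" by simp
  define a b where "a = sqrt (Re (S c c))" and "b = sqrt (Re (S d d))"
  have nn: "Re (S c c) \<ge> 0" for c using psd_nonneg[OF psd] unfolding Q .
  have ab: "a \<ge> 0" "b \<ge> 0" "Re (S c c) = a\<^sup>2" "Re (S d d) = b\<^sup>2" using nn by (auto simp: a_def b_def)
  \<comment> \<open>Both terms of \<open>b * c - a * d\<close> have norm \<open>a * b\<close>.\<close>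
  have "S (\<lambda>z. of_real b * c z - of_real a * d z) (\<lambda>z. of_real b * c z - of_real a * d z) =
      of_real (b * b) * S c c + of_real (a * a) * S d d - of_real (a * b) * (S c d + S d c)"
    unfolding S_def sum_distrib_left sum.distrib[symmetric] sum_subtractf[symmetric]
    by (intro sum.cong refl) (simp add: algebra_simps)
  then have "0 \<le> Re (of_real (b * b) * S c c + of_real (a * a) * S d d - of_real (a * b) * (S c d + S d c))"
    using nn[of "\<lambda>z. of_real b * c z - of_real a * d z"] by (simp only:)
  then have *: "0 \<le> (a * b) * (a * b - Re (S c d))"
    using swap ab(3,4) by (simp add: algebra_simps power2_eq_square)
  show ?thesis
  proof (cases "a * b = 0")
    case False
    then have "a * b > 0" using ab by (simp add: order_less_le)
    then have "Re (S c d) \<le> a * b" using * by (simp add: zero_le_mult_iff)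
    then show ?thesis unfolding S Q a_def b_def .
  next
    case True
    then have "(\<forall>z\<in>A. c z = 0) \<or> (\<forall>z\<in>A. d z = 0)"
      using assms ab unfolding positive_definite_def Q by auto
    then have "S c d = 0" unfolding S_def by (auto intro!: sum.neutral)
    then show ?thesis unfolding S Q using ab(1,2) by (simp add: a_def b_def nn)
  qed
qed

section \<open>The Drury--Arveson kernel\<close>

definition hermitian_inner :: "complex ^ 'd \<Rightarrow> complex ^ 'd \<Rightarrow> complex"
  where "hermitian_inner z w = (\<Sum>i\<in>UNIV. z $ i * cnj (w $ i))"

lemma norm_hermitian_inner_le: "cmod (hermitian_inner z w) \<le> norm z * norm w"
proof -
  have "cmod (hermitian_inner z w) \<le> (\<Sum>i\<in>UNIV. \<bar>cmod (z $ i)\<bar> * \<bar>cmod (w $ i)\<bar>)"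
    unfolding hermitian_inner_def by (rule order_trans[OF norm_sum]) (simp add: norm_mult)
  also have "\<dots> \<le> norm z * norm w"
    unfolding norm_vec_def by (rule L2_set_mult_ineq)
  finally show ?thesis .
qed

lemma norm_hermitian_inner_less:
  assumes "z \<in> ball 0 1" "w \<in> ball 0 1"
  shows "cmod (hermitian_inner z w) < 1"
proof -
  have "norm z < 1" "norm w < 1" using assms by auto
  then have "norm z * norm w < 1"
    using mult_strict_mono[of "norm z" 1 "norm w" 1] by simp
  then show ?thesis using norm_hermitian_inner_le[of z w] by linarith
qed

lemma hermitian_inner_commute: "hermitian_inner w z = cnj (hermitian_inner z w)"
  unfolding hermitian_inner_def by (simp add: mult.commute)

lemma hermitian_inner_self: "hermitian_inner z z = of_real ((norm z)\<^sup>2)"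
  unfolding hermitian_inner_def norm_vec_def L2_set_def
  by (simp add: sum_nonneg complex_norm_square del: of_real_power)

lemma quadratic_form_hermitian_inner:
  "quadratic_form A (\<lambda>z w. hermitian_inner z w * P z w) c =
    (\<Sum>k\<in>UNIV. quadratic_form A P (\<lambda>z. cnj (z $ k) * c z))"
proof -
  have "quadratic_form A (\<lambda>z w. hermitian_inner z w * P z w) c =
      (\<Sum>z\<in>A. \<Sum>w\<in>A. \<Sum>k\<in>UNIV. cnj (cnj (z $ k) * c z) * P z w * (cnj (w $ k) * c w))"
    unfolding quadratic_form_def hermitian_inner_def
    by (intro sum.cong refl) (simp add: sum_distrib_left sum_distrib_right mult_ac)
  also have "\<dots> = (\<Sum>z\<in>A. \<Sum>k\<in>UNIV. \<Sum>w\<in>A. cnj (cnj (z $ k) * c z) * P z w * (cnj (w $ k) * c w))"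
    by (rule sum.cong[OF refl], rule sum.swap)
  also have "\<dots> = (\<Sum>k\<in>UNIV. quadratic_form A P (\<lambda>z. cnj (z $ k) * c z))"
    unfolding quadratic_form_def by (rule sum.swap)
  finally show ?thesis .
qed

lemma quadratic_form_one: "quadratic_form A (\<lambda>z w. 1) c = of_real ((cmod (\<Sum>z\<in>A. c z))\<^sup>2)"
  unfolding complex_norm_square mult.commute[of "sum c A"]
  by (simp add: quadratic_form_def sum_product)

text \<open>Each factor \<open>hermitian_inner z w\<close> is a sum over the coordinates that can be absorbed into the
  coefficients; without factors the form is the squared modulus of the sum of the coefficients.\<close>

lemma quadratic_form_power_nonneg:
  "0 \<le> Re (quadratic_form A (\<lambda>z w. hermitian_inner z w ^ n) c)"
proof (induction n arbitrary: c)
  case 0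
  show ?case by (simp add: quadratic_form_one)
next
  case (Suc n)
  then show ?case
    by (simp add: quadratic_form_hermitian_inner Re_sum sum_nonneg)
qed

lemma drury_arveson_kernel_hermitian_inner:
  "drury_arveson_kernel z w = 1 / (1 - hermitian_inner z w)"
  unfolding drury_arveson_kernel_def hermitian_inner_def ..

lemma drury_arveson_kernel_commute:
  "drury_arveson_kernel w z = cnj (drury_arveson_kernel z w)"
  unfolding drury_arveson_kernel_hermitian_inner by (simp add: hermitian_inner_commute[of w z])

lemma drury_arveson_kernel_inverse:
  assumes "z \<in> ball 0 1" "w \<in> ball 0 1"
  shows "(1 - hermitian_inner z w) * drury_arveson_kernel z w = 1"
  using norm_hermitian_inner_less[OF assms] unfolding drury_arveson_kernel_hermitian_inner by auto

text \<open>The geometric series expands the kernel into powers of the inner product, each of which is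
  positive semidefinite.\<close>

lemma psd_drury_arveson_kernel:
  assumes "A \<subseteq> ball 0 1"
  shows "psd A drury_arveson_kernel"
proof -
  have "0 \<le> Re (quadratic_form A drury_arveson_kernel c)" for c
  proof -
    have "(\<lambda>n. hermitian_inner z w ^ n) sums drury_arveson_kernel z w" if "z \<in> A" "w \<in> A" for z w
      unfolding drury_arveson_kernel_hermitian_inner
      using assms that by (intro geometric_sums norm_hermitian_inner_less) auto
    then have "(\<lambda>n. quadratic_form A (\<lambda>z w. hermitian_inner z w ^ n) c) sums quadratic_form A drury_arveson_kernel c"
      unfolding quadratic_form_def by (intro sums_sum sums_mult sums_mult2)
    then have "(\<lambda>n. Re (quadratic_form A (\<lambda>z w. hermitian_inner z w ^ n) c)) sums Re (quadratic_form A drury_arveson_kernel c)"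
      by (rule sums_Re)
    then show ?thesis
      by (rule sums_le[OF quadratic_form_power_nonneg sums_zero])
  qed
  then show ?thesis
    unfolding psd_def by (intro conjI ballI allI drury_arveson_kernel_commute)
qed

text \<open>This is \<open>K z w = 1 + hermitian_inner z w * K z w\<close> for the kernel \<open>K\<close>, read as an identity of forms.
  All summands on the right are nonnegative, so the null vectors of the form are stable under
  multiplication by the conjugate coordinate functions.\<close>

lemma quadratic_form_drury_arveson:
  assumes "A \<subseteq> ball 0 1"
  shows "quadratic_form A drury_arveson_kernel c = of_real ((cmod (\<Sum>z\<in>A. c z))\<^sup>2)
    + (\<Sum>k\<in>UNIV. quadratic_form A drury_arveson_kernel (\<lambda>z. cnj (z $ k) * c z))"
proof -
  have "quadratic_form A drury_arveson_kernel c =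
      quadratic_form A (\<lambda>z w. 1 * 1 + 1 * (hermitian_inner z w * drury_arveson_kernel z w)) c"
  proof (rule quadratic_form_cong)
    fix z w assume "z \<in> A" "w \<in> A"
    then have "(1 - hermitian_inner z w) * drury_arveson_kernel z w = 1"
      using assms by (intro drury_arveson_kernel_inverse) auto
    then show "drury_arveson_kernel z w = 1 * 1 + 1 * (hermitian_inner z w * drury_arveson_kernel z w)"
      by (simp add: algebra_simps)
  qed auto
  then show ?thesis
    unfolding quadratic_form_linear quadratic_form_hermitian_inner quadratic_form_one by simp
qed

text \<open>The parallelogram law makes the null vectors of a semidefinite form a subspace.\<close>

lemma psd_null_shift:
  assumes "psd A P" "Re (quadratic_form A P c) = 0" "Re (quadratic_form A P d) = 0"
  shows "Re (quadratic_form A P (\<lambda>z. d z - a * c z)) = 0"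
proof -
  have "quadratic_form A P (\<lambda>z. d z - a * c z) + quadratic_form A P (\<lambda>z. d z + a * c z)
      = 2 * quadratic_form A P d + 2 * (a * cnj a) * quadratic_form A P c"
    unfolding quadratic_form_def sum_distrib_left sum.distrib[symmetric]
    by (intro sum.cong refl) (simp add: algebra_simps)
  also have "\<dots> = of_real 2 * quadratic_form A P d + of_real (2 * (cmod a)\<^sup>2) * quadratic_form A P c"
    by (simp add: complex_norm_square[symmetric])
  finally have "Re (quadratic_form A P (\<lambda>z. d z - a * c z)) + Re (quadratic_form A P (\<lambda>z. d z + a * c z))
      = Re (of_real 2 * quadratic_form A P d + of_real (2 * (cmod a)\<^sup>2) * quadratic_form A P c)"
    by (simp only: plus_complex.sel(1)[symmetric])
  also have "\<dots> = 0"
    using assms(2,3) by (simp del: of_real_mult of_real_power of_real_numeral)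
  finally show ?thesis
    using assms psd_nonneg[OF assms(1), of "\<lambda>z. d z - a * c z"] psd_nonneg[OF assms(1), of "\<lambda>z. d z + a * c z"]
    by simp
qed

lemma drury_arveson_null:
  assumes "A \<subseteq> ball 0 1" "Re (quadratic_form A drury_arveson_kernel c) = 0"
  shows "(\<Sum>z\<in>A. c z) = 0"
    and "Re (quadratic_form A drury_arveson_kernel (\<lambda>z. cnj (z $ k) * c z)) = 0"
proof -
  let ?q = "\<lambda>k. Re (quadratic_form A drury_arveson_kernel (\<lambda>z. cnj (z $ k) * c z))"
  have nn: "?q k \<ge> 0" for k
    using psd_nonneg[OF psd_drury_arveson_kernel[OF assms(1)]] .
  have "(cmod (\<Sum>z\<in>A. c z))\<^sup>2 + (\<Sum>k\<in>UNIV. ?q k) = 0"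
    using assms(2) unfolding quadratic_form_drury_arveson[OF assms(1), of c] by (simp add: Re_sum)
  moreover have "(\<Sum>k\<in>UNIV. ?q k) \<ge> 0" using nn by (simp add: sum_nonneg)
  moreover have "(cmod (\<Sum>z\<in>A. c z))\<^sup>2 \<ge> 0" by simp
  ultimately have "(cmod (\<Sum>z\<in>A. c z))\<^sup>2 = 0" "(\<Sum>k\<in>UNIV. ?q k) = 0" by linarith+
  then show "(\<Sum>z\<in>A. c z) = 0" "?q k = 0"
    using nn by (auto simp: sum_nonneg_eq_0_iff)
qed

text \<open>The null vectors form a subspace that is stable under multiplication by conjugate coordinates, and
  their coefficients add up to \<open>0\<close>.  Multiplying a null vector by a product of factors
  \<open>cnj (z $ k) - cnj (b $ k)\<close>, one for each point \<open>b \<noteq> v\<close> of \<open>A\<close>, leaves a null vector supported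
  at \<open>v\<close>, whose coefficient there must therefore be \<open>0\<close>.\<close>

lemma positive_definite_drury_arveson_kernel:
  assumes "finite A" "A \<subseteq> ball 0 1"
  shows "positive_definite A drury_arveson_kernel"
proof -
  have psd: "psd A drury_arveson_kernel" using assms(2) by (rule psd_drury_arveson_kernel)
  have "c v = 0" if c: "Re (quadratic_form A drury_arveson_kernel c) = 0" and v: "v \<in> A" for c v
  proof -
    have "\<exists>d. Re (quadratic_form A drury_arveson_kernel d) = 0 \<and> (\<forall>z\<in>B. d z = 0) \<and> (d v = 0 \<longrightarrow> c v = 0)"
      if "finite B" "B \<subseteq> A - {v}" for B
      using that
    proof (induction B rule: finite_induct)
      case empty
      then show ?case using c by auto
    next
      case (insert b B)
      then obtain d where d: "Re (quadratic_form A drury_arveson_kernel d) = 0" "\<forall>z\<in>B. d z = 0" "d v = 0 \<longrightarrow> c v = 0"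
        by auto
      obtain k where k: "b $ k \<noteq> v $ k" using insert.prems by (auto simp: vec_eq_iff)
      have "Re (quadratic_form A drury_arveson_kernel (\<lambda>z. cnj (z $ k) * d z - cnj (b $ k) * d z)) = 0"
        by (intro psd_null_shift psd d drury_arveson_null assms)
      moreover have "\<forall>z\<in>insert b B. cnj (z $ k) * d z - cnj (b $ k) * d z = 0" using d by auto
      moreover have "cnj (v $ k) * d v - cnj (b $ k) * d v = 0 \<longrightarrow> c v = 0"
        using d k by (auto simp: left_diff_distrib[symmetric])
      ultimately show ?case by blast
    qed
    from this[of "A - {v}"] obtain d where d: "Re (quadratic_form A drury_arveson_kernel d) = 0"
      "\<forall>z\<in>A - {v}. d z = 0" "d v = 0 \<longrightarrow> c v = 0" using assms by auto
    have "(\<Sum>z\<in>A. d z) = d v"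
      using assms d(2) v by (subst sum.remove[of A v]) auto
    then show ?thesis using drury_arveson_null(1)[OF assms(2) d(1)] d(3) by simp
  qed
  then show ?thesis using psd unfolding positive_definite_def by blast
qed

section \<open>Reproducing kernel Hilbert spaces on finite sets\<close>

context reproducing_kernel_Hilbert_space
begin

lemma sum_mem:
  "finite B \<Longrightarrow> (\<And>w. w \<in> B \<Longrightarrow> u w \<in> H) \<Longrightarrow> (\<lambda>z. \<Sum>w\<in>B. c w * u w z) \<in> H"
proof (induction B rule: finite_induct)
  case empty
  then show ?case by (simp add: zero_mem)
next
  case (insert a B)
  have "(\<lambda>z. c a * u a z + (\<Sum>w\<in>B. c w * u w z)) \<in> H"
    using insert by (intro add_mem scale_mem) auto
  then show ?case using insert by simp
qed

lemma ip_sum_right: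
  "finite B \<Longrightarrow> (\<And>w. w \<in> B \<Longrightarrow> u w \<in> H) \<Longrightarrow> g \<in> H \<Longrightarrow>
    ip g (\<lambda>z. \<Sum>w\<in>B. c w * u w z) = (\<Sum>w\<in>B. cnj (c w) * ip g (u w))"
proof (induction B rule: finite_induct)
  case empty
  have "ip (\<lambda>z. 0 * g z) g = 0 * ip g g"
    using empty by (intro ip_scale)
  then have "ip (\<lambda>z. 0) g = 0" by simp
  then show ?case using empty ip_commute[OF zero_mem, of g] by simp
next
  case (insert a B)
  have mem: "u a \<in> H" "(\<lambda>z. c a * u a z) \<in> H" "(\<lambda>z. \<Sum>w\<in>B. c w * u w z) \<in> H"
    using insert by (auto intro!: scale_mem sum_mem)
  have "ip g (\<lambda>z. c a * u a z + (\<Sum>w\<in>B. c w * u w z)) =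
      cnj (ip (\<lambda>z. c a * u a z + (\<Sum>w\<in>B. c w * u w z)) g)"
    using insert mem by (intro ip_commute add_mem)
  also have "\<dots> = cnj (c a) * cnj (ip (u a) g) + cnj (ip (\<lambda>z. \<Sum>w\<in>B. c w * u w z) g)"
    using insert mem by (simp add: ip_add ip_scale)
  also have "\<dots> = cnj (c a) * ip g (u a) + ip g (\<lambda>z. \<Sum>w\<in>B. c w * u w z)"
    using insert mem ip_commute[of _ g] by simp
  finally show ?case using insert by simp
qed

lemma finite_kernel_expansion:
  assumes "finite X" "\<And>z. z \<in> X \<Longrightarrow> (\<Sum>w\<in>X. K z w * c w) = h z" "\<And>z. z \<notin> X \<Longrightarrow> h z = 0"
  shows "h = (\<lambda>z. \<Sum>w\<in>X. c w * kernel_fun X K w z)"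
proof
  fix z
  show "h z = (\<Sum>w\<in>X. c w * kernel_fun X K w z)"
    using assms(2,3)[of z] by (cases "z \<in> X") (auto simp: kernel_fun_def mult.commute)
qed

lemma finite_mem:
  assumes "finite X" "\<And>z. z \<in> X \<Longrightarrow> (\<Sum>w\<in>X. K z w * c w) = h z" "\<And>z. z \<notin> X \<Longrightarrow> h z = 0"
  shows "h \<in> H"
  by (subst finite_kernel_expansion[OF assms]) (simp_all add: assms(1) sum_mem kernel_mem)

text \<open>The reproducing property gives the inner product with a combination of kernel functions.  Since every
  function on a finite set with positive definite kernel is such a combination, the space is unique.\<close>

lemma finite_ip:
  assumes "finite X" "\<And>z. z \<in> X \<Longrightarrow> (\<Sum>w\<in>X. K z w * c w) = h z" "\<And>z. z \<notin> X \<Longrightarrow> h z = 0"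
    and "g \<in> H"
  shows "ip g h = (\<Sum>w\<in>X. g w * cnj (c w))"
  by (subst finite_kernel_expansion[OF assms(1-3)])
    (simp_all add: assms ip_sum_right kernel_mem reproducing mult.commute)

end

text \<open>On a finite set all functions belong to the space.  The matrix \<open>R\<close> inverts the kernel matrix, so that
  \<open>\<Sum>v\<in>A. R w v * h v\<close> is the coefficient of the kernel function at \<open>w\<close> in the expansion of \<open>h\<close>, and
  the inner product is forced by the reproducing property.\<close>

lemma finite_rkhs_exists:
  assumes fin: "finite A" and pd: "positive_definite A K"
    and R: "\<And>h z. z \<in> A \<Longrightarrow> (\<Sum>w\<in>A. K z w * (\<Sum>v\<in>A. R w v * h v)) = (h z :: complex)"
  shows "reproducing_kernel_Hilbert_space A K {h. \<forall>z. z \<notin> A \<longrightarrow> h z = 0}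
    (\<lambda>g h. if (\<forall>z. z \<notin> A \<longrightarrow> g z = 0) \<and> (\<forall>z. z \<notin> A \<longrightarrow> h z = 0)
      then \<Sum>w\<in>A. g w * cnj (\<Sum>v\<in>A. R w v * h v) else 0)"
proof -
  define coef where "coef = (\<lambda>h w. \<Sum>v\<in>A. R w v * h v)"
  define H where "H = {h. \<forall>z. z \<notin> A \<longrightarrow> h z = (0 :: complex)}"
  define ip where "ip = (\<lambda>g h. if g \<in> H \<and> h \<in> H then \<Sum>w\<in>A. g w * cnj (coef h w) else 0)"
  have coef: "z \<in> A \<Longrightarrow> (\<Sum>w\<in>A. K z w * coef h w) = h z" for h z
    using R unfolding coef_def .
  have psd: "psd A K" using pd unfolding positive_definite_def by blast
  have commute: "(\<Sum>w\<in>A. h w * cnj (coef g w)) = cnj (\<Sum>w\<in>A. g w * cnj (coef h w))" for g h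
  proof -
    have "(\<Sum>w\<in>A. h w * cnj (coef g w)) = (\<Sum>w\<in>A. \<Sum>v\<in>A. K w v * coef h v * cnj (coef g w))"
      by (simp add: coef[symmetric, of _ h] sum_distrib_right)
    also have "\<dots> = (\<Sum>v\<in>A. \<Sum>w\<in>A. K w v * coef h v * cnj (coef g w))"
      by (rule sum.swap)
    also have "\<dots> = (\<Sum>v\<in>A. cnj (\<Sum>w\<in>A. K v w * coef g w) * coef h v)"
      by (intro sum.cong refl)
        (simp add: psd_hermitian[OF psd, symmetric] sum_distrib_left mult_ac)
    also have "\<dots> = cnj (\<Sum>w\<in>A. g w * cnj (coef h w))"
      by (simp add: coef)
    finally show ?thesis .
  qed
  have Q: "ip h h = quadratic_form A K (coef h)" if "h \<in> H" for h
  proof -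
    have "(\<Sum>w\<in>A. h w * cnj (coef h w)) = quadratic_form A K (coef h)"
      unfolding quadratic_form_eq_sum by (simp add: coef mult.commute)
    then show ?thesis using that by (simp add: ip_def)
  qed
  \<comment> \<open>Point evaluations are bounded, so Cauchy sequences converge pointwise.\<close>
  have bound: "cmod (h w) \<le> sqrt (Re (K w w)) * hnorm ip h" if "h \<in> H" "w \<in> A" for h w
  proof (cases "h w = 0")
    case True
    have "0 \<le> Re (K w w)" using that(2) by (rule psd_diagonal_nonneg[OF psd fin])
    moreover have "0 \<le> hnorm ip h"
      unfolding hnorm_def Q[OF that(1)] using psd_nonneg[OF psd] by simp
    ultimately show ?thesis using True by simp
  next
    case False
    let ?d = "\<lambda>z. if z = w then h w else 0"
    have "(\<Sum>z\<in>A. cnj (?d z) * (\<Sum>v\<in>A. K z v * coef h v)) = cnj (h w) * h w"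
      using that fin by (simp add: coef if_distrib if_distribR sum.delta cong: if_cong)
    also have "\<dots> = of_real ((cmod (h w))\<^sup>2)"
      unfolding complex_norm_square by simp
    finally have "(cmod (h w))\<^sup>2 = Re (\<Sum>z\<in>A. cnj (?d z) * (\<Sum>v\<in>A. K z v * coef h v))"
      by (simp only: Re_complex_of_real)
    also have "\<dots> \<le> sqrt (Re (quadratic_form A K ?d)) * sqrt (Re (quadratic_form A K (coef h)))"
      by (rule positive_definite_Cauchy_Schwarz[OF pd])
    also have "quadratic_form A K ?d = quadratic_form {w} K ?d"
      using fin that by (intro quadratic_form_mono_neutral) auto
    also have "\<dots> = of_real ((cmod (h w))\<^sup>2) * K w w"
      unfolding complex_norm_square by (simp add: quadratic_form_def)
    finally have "(cmod (h w))\<^sup>2 \<le> cmod (h w) * (sqrt (Re (K w w)) * hnorm ip h)"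
      by (simp add: real_sqrt_mult hnorm_def Q[OF that(1)] mult.assoc)
    then show ?thesis using False by (simp add: power2_eq_square)
  qed
  have "reproducing_kernel_Hilbert_space A K H ip"
  proof
    show "h z = 0" if "h \<in> H" "z \<notin> A" for h z using that unfolding H_def by auto
    show "(\<lambda>z. 0) \<in> H" "g \<in> H \<Longrightarrow> h \<in> H \<Longrightarrow> (\<lambda>z. g z + h z) \<in> H" "h \<in> H \<Longrightarrow> (\<lambda>z. c * h z) \<in> H" for g h c
      unfolding H_def by auto
    show "ip g h = 0" if "g \<notin> H \<or> h \<notin> H" for g h using that unfolding ip_def by auto
    show "ip (\<lambda>z. g z + g' z) h = ip g h + ip g' h" if "g \<in> H" "g' \<in> H" "h \<in> H" for g g' h
      using that unfolding ip_def by (simp add: H_def distrib_right sum.distrib)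
    show "ip (\<lambda>z. c * g z) h = c * ip g h" if "g \<in> H" "h \<in> H" for c g h
      using that unfolding ip_def by (simp add: H_def sum_distrib_left mult.assoc)
    show "ip h g = cnj (ip g h)" if "g \<in> H" "h \<in> H" for g h
      using that commute unfolding ip_def by simp
    show "Re (ip h h) > 0" if "h \<in> H" "h \<noteq> (\<lambda>z. 0)" for h
    proof (rule ccontr)
      assume "\<not> Re (ip h h) > 0"
      then have "Re (quadratic_form A K (coef h)) = 0"
        using psd_nonneg[OF psd, of "coef h"] Q[OF that(1)] by simp
      then have "coef h w = 0" if "w \<in> A" for w
        using positive_definite_null[OF pd _ that] by blast
      then have "h z = 0" if "z \<in> A" for z
        using coef[OF that, of h] by simp
      then have "h = (\<lambda>z. 0)" using that(1) unfolding H_def by fastforce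
      then show False using that(2) by blast
    qed
    show K: "kernel_fun A K w \<in> H" for w
      unfolding H_def kernel_fun_def by simp
    show "ip h (kernel_fun A K w) = h w" if "h \<in> H" "w \<in> A" for h w
    proof -
      have "coef (kernel_fun A K w) v = (if v = w then 1 else 0)" if "v \<in> A" for v
      proof (rule positive_definite_injective[OF pd _ that])
        fix z assume "z \<in> A"
        then show "(\<Sum>v\<in>A. K z v * coef (kernel_fun A K w) v) = (\<Sum>v\<in>A. K z v * (if v = w then 1 else 0))"
          using \<open>w \<in> A\<close> fin unfolding coef[OF \<open>z \<in> A\<close>]
          by (simp add: kernel_fun_def if_distrib sum.delta cong: if_cong)
      qed
      then have "ip h (kernel_fun A K w) = (\<Sum>v\<in>A. if v = w then h v else 0)"
        using that K unfolding ip_def by (auto intro!: sum.cong)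
      then show ?thesis using that fin by simp
    qed
    fix u :: "nat \<Rightarrow> 'a \<Rightarrow> complex"
    assume u: "range u \<subseteq> H"
      and Cauchy: "\<And>e. e > 0 \<Longrightarrow> \<exists>N. \<forall>i\<ge>N. \<forall>j\<ge>N. hnorm ip (\<lambda>z. u i z - u j z) < e"
    have uH: "u i \<in> H" for i using u by auto
    have diff: "(\<lambda>z. u i z - x z) \<in> H" if "x \<in> H" for i x
      using uH that unfolding H_def by auto
    have "\<exists>l. (\<lambda>i. u i w) \<longlonglongrightarrow> l" if w: "w \<in> A" for w
    proof -
      have "Cauchy (\<lambda>i. u i w)"
      proof (rule metric_CauchyI)
        fix e :: real assume e: "e > 0"
        define k where "k = \<bar>sqrt (Re (K w w))\<bar> + 1"
        have k: "k > 0" "sqrt (Re (K w w)) \<le> k" unfolding k_def by auto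
        obtain N where N: "\<forall>i\<ge>N. \<forall>j\<ge>N. hnorm ip (\<lambda>z. u i z - u j z) < e / k"
          using Cauchy[of "e / k"] e k by auto
        have "dist (u i w) (u j w) < e" if "i \<ge> N" "j \<ge> N" for i j
        proof -
          have nn: "0 \<le> hnorm ip (\<lambda>z. u i z - u j z)"
            unfolding hnorm_def Q[OF diff[OF uH]] using psd_nonneg[OF psd] by simp
          have "dist (u i w) (u j w) \<le> sqrt (Re (K w w)) * hnorm ip (\<lambda>z. u i z - u j z)"
            using bound[OF diff[OF uH] w] by (simp add: dist_norm)
          also have "\<dots> \<le> k * hnorm ip (\<lambda>z. u i z - u j z)"
            using k nn by (intro mult_right_mono) auto
          also have "\<dots> < k * (e / k)"
            using N that k by (intro mult_strict_left_mono) auto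
          finally show ?thesis using k by simp
        qed
        then show "\<exists>M. \<forall>m\<ge>M. \<forall>n\<ge>M. dist (u m w) (u n w) < e" by blast
      qed
      then show ?thesis by (meson Cauchy_convergent_iff convergent_def)
    qed
    then obtain l where l: "\<And>w. w \<in> A \<Longrightarrow> (\<lambda>i. u i w) \<longlonglongrightarrow> l w" by metis
    define h where "h = (\<lambda>w. if w \<in> A then l w else 0)"
    have hH: "h \<in> H" unfolding H_def h_def by simp
    have lim: "(\<lambda>i. u i w - h w) \<longlonglongrightarrow> 0" if "w \<in> A" for w
      using l[OF that] that unfolding h_def by (simp add: LIM_zero)
    have "(\<lambda>i. sqrt (Re (\<Sum>w\<in>A. (u i w - h w) * cnj (\<Sum>v\<in>A. R w v * (u i v - h v)))))
        \<longlonglongrightarrow> sqrt (Re (\<Sum>w\<in>A. 0 * cnj (\<Sum>v\<in>A. R w v * 0)))"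
      by (intro tendsto_intros lim)
    then have "(\<lambda>i. hnorm ip (\<lambda>z. u i z - h z)) \<longlonglongrightarrow> 0"
      unfolding hnorm_def ip_def coef_def using diff[OF hH] by simp
    then show "\<exists>h\<in>H. (\<lambda>i. hnorm ip (\<lambda>z. u i z - h z)) \<longlonglongrightarrow> 0"
      using hH by blast
  qed
  then show ?thesis unfolding H_def ip_def coef_def by simp
qed

lemma positive_definite_inverse:
  assumes "finite A" "positive_definite A K"
  shows "\<exists>R. \<forall>h. \<forall>z\<in>A. (\<Sum>w\<in>A. K z w * (\<Sum>v\<in>A. R w v * h v)) = h z"
proof -
  have "\<forall>v. \<exists>c. \<forall>z\<in>A. (\<Sum>w\<in>A. K z w * c w) = (if z = v then 1 else 0)"
    by (intro allI positive_definite_surjective[OF assms])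
  then obtain R where R: "\<And>v z. z \<in> A \<Longrightarrow> (\<Sum>w\<in>A. K z w * R v w) = (if z = v then 1 else 0)"
    by metis
  have "(\<Sum>w\<in>A. K z w * (\<Sum>v\<in>A. R v w * h v)) = h z" if "z \<in> A" for h z
  proof -
    have "(\<Sum>w\<in>A. K z w * (\<Sum>v\<in>A. R v w * h v)) = (\<Sum>w\<in>A. \<Sum>v\<in>A. K z w * R v w * h v)"
      by (simp add: sum_distrib_left mult.assoc)
    also have "\<dots> = (\<Sum>v\<in>A. \<Sum>w\<in>A. K z w * R v w * h v)"
      by (rule sum.swap)
    also have "\<dots> = (\<Sum>v\<in>A. if z = v then h v else 0)"
      by (intro sum.cong refl) (simp add: sum_distrib_right[symmetric] R[OF that])
    finally show ?thesis using that assms(1) by simp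
  qed
  then show ?thesis by (intro exI[of _ "\<lambda>w v. R v w"]) blast
qed

text \<open>The defining description of the space is turned into an explicit one, with \<open>coef h\<close> the
  coefficients of \<open>h\<close> in the basis of kernel functions.\<close>

lemma rkhs_finite:
  assumes "finite A" "positive_definite A K"
  obtains coef where "\<And>h z. z \<in> A \<Longrightarrow> (\<Sum>w\<in>A. K z w * coef h w) = h z"
    and "rkhs A K = ({h. \<forall>z. z \<notin> A \<longrightarrow> h z = 0},
      \<lambda>g h. if (\<forall>z. z \<notin> A \<longrightarrow> g z = 0) \<and> (\<forall>z. z \<notin> A \<longrightarrow> h z = 0)
        then \<Sum>w\<in>A. g w * cnj (coef h w) else 0)"
proof -
  obtain R where R: "\<And>h z. z \<in> A \<Longrightarrow> (\<Sum>w\<in>A. K z w * (\<Sum>v\<in>A. R w v * h v)) = h z"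
    using positive_definite_inverse[OF assms] by blast
  define coef where "coef = (\<lambda>h w. \<Sum>v\<in>A. R w v * h v)"
  define H where "H = {h. \<forall>z. z \<notin> A \<longrightarrow> h z = (0 :: complex)}"
  define ip where "ip = (\<lambda>g h. if (\<forall>z. z \<notin> A \<longrightarrow> g z = 0) \<and> (\<forall>z. z \<notin> A \<longrightarrow> h z = 0)
        then \<Sum>w\<in>A. g w * cnj (coef h w) else 0)"
  have coef: "\<And>h z. z \<in> A \<Longrightarrow> (\<Sum>w\<in>A. K z w * coef h w) = h z"
    using R unfolding coef_def .
  have ex: "reproducing_kernel_Hilbert_space A K H ip"
    using finite_rkhs_exists[OF assms R] unfolding H_def ip_def coef_def .
  have unique: "H' = H \<and> ip' = ip" if "reproducing_kernel_Hilbert_space A K H' ip'" for H' ip'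
  proof -
    interpret L: reproducing_kernel_Hilbert_space A K H' ip' by (rule that)
    have "h \<in> H'" if "h \<in> H" for h
      using that by (intro L.finite_mem[OF assms(1), of "coef h"] coef) (auto simp: H_def)
    then have H': "H' = H" using L.supported unfolding H_def by auto
    have "ip' g h = ip g h" for g h
    proof (cases "g \<in> H \<and> h \<in> H")
      case True
      then have "ip' g h = (\<Sum>w\<in>A. g w * cnj (coef h w))"
        using coef H' by (intro L.finite_ip[OF assms(1)]) (auto simp: H_def)
      then show ?thesis using True by (simp add: ip_def H_def)
    next
      case False
      then have "ip' g h = 0" using L.ip_outside[of g h] unfolding H' by blast
      then show ?thesis using False unfolding ip_def H_def by auto
    qed
    then show ?thesis using H' by auto
  qed
  have "rkhs A K = (H, ip)"
    unfolding rkhs_def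
  proof (rule the_equality)
    show "case (H, ip) of (H, ip) \<Rightarrow> reproducing_kernel_Hilbert_space A K H ip"
      using ex by simp
    fix x assume x: "case x of (H, ip) \<Rightarrow> reproducing_kernel_Hilbert_space A K H ip"
    obtain H' ip' where "x = (H', ip')" by (cases x)
    then show "x = (H, ip)" using unique[of H' ip'] x by simp
  qed
  then show ?thesis unfolding H_def ip_def using coef by (rule that[rotated])
qed

lemma mult_norm_finite_nonneg:
  assumes "finite A" "positive_definite A K"
  shows "0 \<le> mult_norm A K g"
proof -
  obtain coef where rkhs: "rkhs A K = ({h. \<forall>z. z \<notin> A \<longrightarrow> h z = 0},
      \<lambda>g h. if (\<forall>z. z \<notin> A \<longrightarrow> g z = 0) \<and> (\<forall>z. z \<notin> A \<longrightarrow> h z = 0)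
        then \<Sum>w\<in>A. g w * cnj (coef h w) else 0)"
    using rkhs_finite[OF assms] by blast
  show ?thesis
    unfolding mult_norm_def rkhs by (auto intro!: SUP_upper2[of "\<lambda>z. 0"] simp: hnorm_def)
qed

text \<open>An operator and its adjoint have the same norm, and the adjoint of multiplication by \<open>g\<close>
  multiplies the coefficient at \<open>w\<close> by \<open>cnj (g w)\<close>.  The form on the right, at \<open>c\<close>, is
  \<open>C\<^sup>2\<close> times the squared norm of the function with coefficients \<open>c\<close>, minus the squared norm of its
  image under the adjoint.\<close>

lemma mult_norm_finite_le_iff:
  assumes fin: "finite A" and pd: "positive_definite A K" and C: "0 \<le> C"
  shows "mult_norm A K g \<le> ereal C \<longleftrightarrow> psd A (\<lambda>z w. (of_real (C\<^sup>2) - g z * cnj (g w)) * K z w)"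
proof -
  obtain coef where coef: "\<And>h z. z \<in> A \<Longrightarrow> (\<Sum>w\<in>A. K z w * coef h w) = h z"
    and rkhs: "rkhs A K = ({h. \<forall>z. z \<notin> A \<longrightarrow> h z = 0},
      \<lambda>g h. if (\<forall>z. z \<notin> A \<longrightarrow> g z = 0) \<and> (\<forall>z. z \<notin> A \<longrightarrow> h z = 0)
        then \<Sum>w\<in>A. g w * cnj (coef h w) else 0)"
    using rkhs_finite[OF fin pd] by blast
  have psd: "psd A K" using pd unfolding positive_definite_def by blast
  define N where "N = (\<lambda>c. sqrt (Re (quadratic_form A K c)))"
  have N0: "N c \<ge> 0" and N2: "(N c)\<^sup>2 = Re (quadratic_form A K c)" for c
    using psd_nonneg[OF psd] unfolding N_def by auto
  define H where "H = {h. \<forall>z. z \<notin> A \<longrightarrow> h z = (0 :: complex)}"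
  obtain ip where rkhs': "rkhs A K = (H, ip)"
    and ip: "\<And>h. h \<in> H \<Longrightarrow> ip h h = (\<Sum>w\<in>A. h w * cnj (coef h w))"
    using rkhs unfolding H_def by auto
  have norm: "hnorm ip h = N (coef h)" if "h \<in> H" for h
    unfolding hnorm_def N_def ip[OF that] quadratic_form_eq_sum by (simp add: coef mult.commute)
  have mem: "(\<lambda>z. g z * h z) \<in> H" if "h \<in> H" for h
    using that unfolding H_def by auto
  have mult: "mult_norm A K g = (SUP h\<in>{h \<in> H. hnorm ip h \<le> 1}. ereal (hnorm ip (\<lambda>z. g z * h z)))"
    unfolding mult_norm_def rkhs' using mem by simp
  have coef_scale: "N (coef (\<lambda>z. a * h z)) = cmod a * N (coef h)" for a h
  proof -
    have "coef (\<lambda>z. a * h z) z = a * coef h z" if "z \<in> A" for z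
    proof (rule positive_definite_injective[OF pd _ that])
      fix z assume z: "z \<in> A"
      have "(\<Sum>w\<in>A. K z w * (a * coef h w)) = a * (\<Sum>w\<in>A. K z w * coef h w)"
        by (simp add: sum_distrib_left mult_ac)
      then show "(\<Sum>w\<in>A. K z w * coef (\<lambda>z. a * h z) w) = (\<Sum>w\<in>A. K z w * (a * coef h w))"
        using coef[OF z] by simp
    qed
    then have "quadratic_form A K (coef (\<lambda>z. a * h z)) = quadratic_form A K (\<lambda>z. a * coef h z)"
      by (intro quadratic_form_cong) auto
    also have "\<dots> = (a * cnj a) * quadratic_form A K (coef h)"
      by (simp add: quadratic_form_def sum_distrib_left mult_ac)
    also have "\<dots> = of_real ((cmod a)\<^sup>2) * quadratic_form A K (coef h)"
      by (simp only: complex_norm_square)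
    finally show ?thesis unfolding N_def
      by (simp add: real_sqrt_mult del: of_real_power)
  qed
  have form: "Re (quadratic_form A (\<lambda>z w. (of_real (C\<^sup>2) - g z * cnj (g w)) * K z w) c)
      = (C * N c)\<^sup>2 - (N (\<lambda>z. cnj (g z) * c z))\<^sup>2" for c
  proof -
    have "quadratic_form A (\<lambda>z w. (of_real (C\<^sup>2) - g z * cnj (g w)) * K z w) c =
        of_real (C\<^sup>2) * quadratic_form A K c - quadratic_form A K (\<lambda>z. cnj (g z) * c z)"
      unfolding quadratic_form_def sum_distrib_left sum_subtractf[symmetric]
      by (intro sum.cong refl) (simp add: algebra_simps)
    then show ?thesis
      unfolding power_mult_distrib N2 by (simp del: of_real_power)
  qed
  have herm: "(of_real (C\<^sup>2) - g w * cnj (g z)) * K w z = cnj ((of_real (C\<^sup>2) - g z * cnj (g w)) * K z w)"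
    if "z \<in> A" "w \<in> A" for z w
    by (simp add: psd_hermitian[OF psd, symmetric] that mult.commute)
  have "psd A (\<lambda>z w. (of_real (C\<^sup>2) - g z * cnj (g w)) * K z w) \<longleftrightarrow>
      (\<forall>c. (N (\<lambda>z. cnj (g z) * c z))\<^sup>2 \<le> (C * N c)\<^sup>2)"
    unfolding psd_def form using herm by auto
  also have "\<dots> \<longleftrightarrow> (\<forall>c. N (\<lambda>z. cnj (g z) * c z) \<le> C * N c)"
    using N0 C by (simp add: power2_le_iff_abs_le abs_mult)
  also have "\<dots> \<longleftrightarrow> (\<forall>h\<in>H. N (coef (\<lambda>z. g z * h z)) \<le> C * N (coef h))"
  proof safe
    fix h assume adj: "\<forall>c. N (\<lambda>z. cnj (g z) * c z) \<le> C * N c" and h: "h \<in> H"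
    define a where "a = coef (\<lambda>z. g z * h z)"
    have "(N a)\<^sup>2 = Re (\<Sum>z\<in>A. cnj (a z) * (g z * h z))"
      unfolding N2 quadratic_form_eq_sum by (simp add: a_def coef)
    also have "\<dots> = Re (\<Sum>z\<in>A. cnj (cnj (g z) * a z) * (\<Sum>w\<in>A. K z w * coef h w))"
      by (simp add: coef mult_ac)
    also have "\<dots> \<le> N (\<lambda>z. cnj (g z) * a z) * N (coef h)"
      unfolding N_def by (rule positive_definite_Cauchy_Schwarz[OF pd])
    also have "\<dots> \<le> C * N a * N (coef h)"
      using adj N0 by (intro mult_right_mono) auto
    finally have "N a * N a \<le> N a * (C * N (coef h))"
      by (simp add: power2_eq_square mult_ac)
    then have "N a \<le> C * N (coef h)"
      using N0[of a] N0[of "coef h"] C by (cases "N a = 0") (auto simp: mult_le_cancel_left)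
    then show "N (coef (\<lambda>z. g z * h z)) \<le> C * N (coef h)" unfolding a_def .
  next
    fix c assume *: "\<forall>h\<in>H. N (coef (\<lambda>z. g z * h z)) \<le> C * N (coef h)"
    define d where "d = (\<lambda>z. cnj (g z) * c z)"
    define h where "h = (\<lambda>z. if z \<in> A then \<Sum>w\<in>A. K z w * d w else 0)"
    have h: "h \<in> H" unfolding h_def H_def by simp
    have "coef h z = d z" if "z \<in> A" for z
      by (rule positive_definite_injective[OF pd _ that]) (simp add: coef, simp add: h_def)
    then have Nh: "N (coef h) = N d"
      unfolding N_def by (intro arg_cong[of _ _ "\<lambda>x. sqrt (Re x)"] quadratic_form_cong) auto
    have "(N d)\<^sup>2 = Re (\<Sum>z\<in>A. cnj (c z) * (g z * h z))"
      unfolding N2 quadratic_form_eq_sum by (intro arg_cong[of _ _ Re] sum.cong refl) (simp add: h_def d_def mult_ac)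
    also have "\<dots> = Re (\<Sum>z\<in>A. cnj (c z) * (\<Sum>w\<in>A. K z w * coef (\<lambda>z. g z * h z) w))"
      by (simp add: coef)
    also have "\<dots> \<le> N c * N (coef (\<lambda>z. g z * h z))"
      unfolding N_def by (rule positive_definite_Cauchy_Schwarz[OF pd])
    also have "\<dots> \<le> N c * (C * N d)"
      using *[rule_format, OF h] N0[of c] unfolding Nh by (intro mult_left_mono) auto
    finally have "N d * N d \<le> N d * (C * N c)"
      by (simp add: power2_eq_square mult_ac)
    then have "N d \<le> C * N c"
      using N0[of d] N0[of c] C by (cases "N d = 0") (auto simp: mult_le_cancel_left)
    then show "N (\<lambda>z. cnj (g z) * c z) \<le> C * N c" unfolding d_def .
  qed
  also have "\<dots> \<longleftrightarrow> (\<forall>h\<in>{h \<in> H. hnorm ip h \<le> 1}. hnorm ip (\<lambda>z. g z * h z) \<le> C)"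
  proof safe
    fix h assume "\<forall>h\<in>H. N (coef (\<lambda>z. g z * h z)) \<le> C * N (coef h)" "h \<in> H" "hnorm ip h \<le> 1"
    then show "hnorm ip (\<lambda>z. g z * h z) \<le> C"
      using mult_left_mono[of "N (coef h)" 1 C] C unfolding norm[OF mem[OF \<open>h \<in> H\<close>]] norm[OF \<open>h \<in> H\<close>]
      by fastforce
  next
    fix h assume *: "\<forall>h\<in>{h \<in> H. hnorm ip h \<le> 1}. hnorm ip (\<lambda>z. g z * h z) \<le> C" and h: "h \<in> H"
    show "N (coef (\<lambda>z. g z * h z)) \<le> C * N (coef h)"
    proof (cases "N (coef h) = 0")
      case True
      then have "Re (quadratic_form A K (coef h)) = 0" unfolding N_def by simp
      then have "coef h z = 0" if "z \<in> A" for z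
        using positive_definite_null[OF pd _ that] by blast
      then have "h z = 0" if "z \<in> A" for z using coef[OF that, of h] by simp
      then have "h = (\<lambda>z. 0)" using h unfolding H_def by fastforce
      then have "(\<lambda>z. g z * h z) = h" by auto
      then show ?thesis using True by simp
    next
      case False
      define t where "t = N (coef h)"
      have t: "t > 0" using False N0[of "coef h"] unfolding t_def by simp
      define x where "x = (\<lambda>z. of_real (1 / t) * h z)"
      have x: "x \<in> H" using h unfolding x_def H_def by simp
      have "hnorm ip x = 1"
        unfolding norm[OF x] unfolding x_def coef_scale using t unfolding t_def[symmetric] by (simp add: norm_divide)
      then have "N (coef (\<lambda>z. g z * x z)) \<le> C"
        using * x norm[OF mem[OF x]] by force
      moreover have "(\<lambda>z. g z * x z) = (\<lambda>z. of_real (1 / t) * (g z * h z))"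
        by (simp add: x_def mult_ac)
      ultimately have "cmod (of_real (1 / t)) * N (coef (\<lambda>z. g z * h z)) \<le> C"
        by (simp only: coef_scale)
      then have "1 / t * N (coef (\<lambda>z. g z * h z)) \<le> C"
        using t by (simp add: norm_divide)
      then show ?thesis using t unfolding t_def[symmetric] by (simp add: field_simps)
    qed
  qed
  also have "\<dots> \<longleftrightarrow> mult_norm A K g \<le> ereal C"
    unfolding mult by (simp add: SUP_le_iff)
  finally show ?thesis by blast
qed

section \<open>Operator norms and adjoints\<close>

lemma complex_inner_def: "(x :: complex) \<bullet> y = Re (cnj x * y)"
  by (simp add: inner_complex_def)

text \<open>The inner product on \<open>complex ^ 'n\<close> is the real one, the real part of the Hermitian product.  It
  has the same norm, and the conjugate transpose is the adjoint for it as well.\<close>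

lemma conj_transpose_adjoint: "(A *v x) \<bullet> y = x \<bullet> (conj_transpose A *v y)"
  for A :: "complex ^ 'n ^ 'm"
proof -
  have "(A *v x) \<bullet> y = (\<Sum>i\<in>UNIV. \<Sum>j\<in>UNIV. Re (cnj (A $ i $ j * x $ j) * y $ i))"
    by (simp only: inner_vec_def matrix_vector_mult_def vec_lambda_beta complex_inner_def cnj_sum sum_distrib_right Re_sum)
  also have "\<dots> = (\<Sum>j\<in>UNIV. \<Sum>i\<in>UNIV. Re (cnj (A $ i $ j * x $ j) * y $ i))"
    by (rule sum.swap)
  also have "\<dots> = (\<Sum>j\<in>UNIV. \<Sum>i\<in>UNIV. Re (cnj (x $ j) * (conj_transpose A $ j $ i * y $ i)))"
    by (simp only: conj_transpose_def vec_lambda_beta complex_cnj_mult mult_ac)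
  also have "\<dots> = x \<bullet> (conj_transpose A *v y)"
    by (simp only: inner_vec_def matrix_vector_mult_def vec_lambda_beta complex_inner_def sum_distrib_left Re_sum)
  finally show ?thesis .
qed

lemma conj_transpose_conj_transpose [simp]: "conj_transpose (conj_transpose A) = A"
  by (simp add: conj_transpose_def vec_eq_iff)

lemma conj_transpose_mult: "conj_transpose (A ** B) = conj_transpose B ** conj_transpose A"
  by (simp add: conj_transpose_def matrix_matrix_mult_def vec_eq_iff mult.commute)

lemma conj_transpose_mat_1 [simp]: "conj_transpose (mat 1) = mat 1"
  by (simp add: conj_transpose_def mat_def vec_eq_iff)

lemma conj_transpose_diag_matrix: "conj_transpose (diag_matrix v) = diag_matrix (\<chi> j. cnj (v $ j))"
  by (simp add: conj_transpose_def diag_matrix_def vec_eq_iff)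

lemma op_norm_le_iff:
  fixes A :: "complex ^ 'n ^ 'm"
  assumes "0 \<le> C"
  shows "op_norm A \<le> C \<longleftrightarrow> (\<forall>x. norm (A *v x) \<le> C * norm x)"
proof
  assume "op_norm A \<le> C"
  then show "\<forall>x. norm (A *v x) \<le> C * norm x"
    using onorm[of "\<lambda>x. A *v x"] unfolding op_norm_def
    by (meson matrix_vector_mul_bounded_linear mult_right_mono norm_ge_zero order_trans)
next
  assume "\<forall>x. norm (A *v x) \<le> C * norm x"
  then show "op_norm A \<le> C" unfolding op_norm_def using assms by (intro onorm_bound) auto
qed

lemma adjoint_norm_le:
  fixes A :: "complex ^ 'n ^ 'm"
  assumes "0 \<le> C" "\<forall>x. norm (A *v x) \<le> C * norm x"
  shows "norm (conj_transpose A *v y) \<le> C * norm y"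
proof -
  let ?z = "conj_transpose A *v y"
  have "norm ?z * norm ?z = ?z \<bullet> ?z" by (simp add: dot_square_norm power2_eq_square)
  also have "\<dots> = (A *v ?z) \<bullet> y" by (rule conj_transpose_adjoint[symmetric])
  also have "\<dots> \<le> norm (A *v ?z) * norm y" by (rule norm_cauchy_schwarz)
  also have "\<dots> \<le> (C * norm ?z) * norm y" using assms by (intro mult_right_mono) auto
  finally have "norm ?z * norm ?z \<le> norm ?z * (C * norm y)" by (simp add: mult_ac)
  then show ?thesis using assms(1) by (cases "norm ?z = 0") (auto simp: mult_le_cancel_left)
qed

lemma op_norm_le_iff_adjoint:
  assumes "0 \<le> C"
  shows "op_norm A \<le> C \<longleftrightarrow> (\<forall>x. (norm (conj_transpose A *v x))\<^sup>2 \<le> C\<^sup>2 * (norm x)\<^sup>2)"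
proof -
  have "op_norm A \<le> C \<longleftrightarrow> (\<forall>x. norm (conj_transpose A *v x) \<le> C * norm x)"
    unfolding op_norm_le_iff[OF assms]
    using adjoint_norm_le[OF assms, of A] adjoint_norm_le[OF assms, of "conj_transpose A"] by auto
  also have "\<dots> \<longleftrightarrow> (\<forall>x. (norm (conj_transpose A *v x))\<^sup>2 \<le> (C * norm x)\<^sup>2)"
    using assms by (simp add: power2_le_iff_abs_le abs_mult)
  finally show ?thesis by (simp add: power_mult_distrib)
qed

text \<open>With \<open>R = \<Sum>i. T i ** conj_transpose (T i)\<close>, the sum of squares is \<open>R *v x \<bullet> x\<close>.  For the converse,
  the squared norm of \<open>R *v x\<close> is \<open>\<Sum>i. conj_transpose (T i) *v x \<bullet> conj_transpose (T i) *v (R *v x)\<close>,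
  which the Cauchy--Schwarz inequality bounds by \<open>norm x * norm (R *v x)\<close>.\<close>

lemma row_contraction_iff:
  fixes T :: "'d::finite \<Rightarrow> complex ^ 'n ^ 'n"
  shows "sqrt (op_norm (\<Sum>i\<in>UNIV. T i ** conj_transpose (T i))) \<le> 1 \<longleftrightarrow>
    (\<forall>x. (\<Sum>i\<in>UNIV. (norm (conj_transpose (T i) *v x))\<^sup>2) \<le> (norm x)\<^sup>2)"
proof -
  define R where "R = (\<Sum>i\<in>UNIV. T i ** conj_transpose (T i))"
  let ?t = "\<lambda>x i. conj_transpose (T i) *v x"
  have R_apply: "R *v x = (\<Sum>i\<in>UNIV. T i *v ?t x i)" for x
  proof -
    have "(\<Sum>i\<in>I. T i ** conj_transpose (T i)) *v x = (\<Sum>i\<in>I. T i *v ?t x i)" if "finite I" for I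
      using that by (induction I rule: finite_induct)
        (simp_all add: matrix_vector_mult_add_rdistrib matrix_vector_mul_assoc)
    then show ?thesis unfolding R_def by simp
  qed
  have R: "(R *v x) \<bullet> y = (\<Sum>i\<in>UNIV. ?t x i \<bullet> ?t y i)" for x y
    unfolding R_apply inner_sum_left conj_transpose_adjoint ..
  have sq: "(\<Sum>i\<in>UNIV. (norm (?t x i))\<^sup>2) = (R *v x) \<bullet> x" for x
    unfolding R by (simp add: dot_square_norm)
  have "op_norm R \<le> 1 \<longleftrightarrow> (\<forall>x. (\<Sum>i\<in>UNIV. (norm (?t x i))\<^sup>2) \<le> (norm x)\<^sup>2)"
  proof
    assume "op_norm R \<le> 1"
    then have le: "norm (R *v x) \<le> norm x" for x using op_norm_le_iff[of 1 R] by simp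
    show "\<forall>x. (\<Sum>i\<in>UNIV. (norm (?t x i))\<^sup>2) \<le> (norm x)\<^sup>2"
    proof
      fix x
      have "(R *v x) \<bullet> x \<le> norm (R *v x) * norm x" by (rule norm_cauchy_schwarz)
      also have "\<dots> \<le> norm x * norm x" using le by (intro mult_right_mono) auto
      finally show "(\<Sum>i\<in>UNIV. (norm (?t x i))\<^sup>2) \<le> (norm x)\<^sup>2" unfolding sq by (simp add: power2_eq_square)
    qed
  next
    assume *: "\<forall>x. (\<Sum>i\<in>UNIV. (norm (?t x i))\<^sup>2) \<le> (norm x)\<^sup>2"
    have L2: "L2_set (\<lambda>i. norm (?t x i)) UNIV \<le> norm x" for x
      using * unfolding L2_set_def by (intro real_le_lsqrt) (auto simp: sum_nonneg)
    have "norm (R *v x) \<le> 1 * norm x" for x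
    proof -
      let ?y = "R *v x"
      have "norm ?y * norm ?y = (R *v x) \<bullet> ?y" by (simp add: dot_square_norm power2_eq_square)
      also have "\<dots> \<le> (\<Sum>i\<in>UNIV. \<bar>norm (?t x i)\<bar> * \<bar>norm (?t ?y i)\<bar>)"
        unfolding R by (intro sum_mono) (simp add: norm_cauchy_schwarz)
      also have "\<dots> \<le> L2_set (\<lambda>i. norm (?t x i)) UNIV * L2_set (\<lambda>i. norm (?t ?y i)) UNIV"
        by (rule L2_set_mult_ineq)
      also have "\<dots> \<le> norm x * norm ?y"
        using L2 by (intro mult_mono) auto
      finally show ?thesis by (cases "norm ?y = 0") (auto simp: mult_le_cancel_right)
    qed
    then show "op_norm R \<le> 1" using op_norm_le_iff[of 1 R] by auto
  qed
  then show ?thesis unfolding R_def by simp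
qed

section \<open>Diagonalizable tuples and Gram matrices\<close>

lemma matrix_inverse:
  assumes "invertible S"
  shows "S ** matrix_inv S = mat 1" "matrix_inv S ** S = mat 1"
proof -
  have "S ** matrix_inv S = mat 1 \<and> matrix_inv S ** S = mat 1"
    using assms unfolding invertible_def matrix_inv_def by (rule someI_ex)
  then show "S ** matrix_inv S = mat 1" "matrix_inv S ** S = mat 1" by auto
qed

lemma matrix_mult_diag_entry: "(M ** diag_matrix v) $ j $ k = M $ j $ k * v $ k"
  unfolding matrix_matrix_mult_def diag_matrix_def by (simp add: if_distrib cong: if_cong)

lemma diag_mult_matrix_entry: "(diag_matrix v ** M) $ j $ k = v $ j * M $ j $ k"
  unfolding matrix_matrix_mult_def diag_matrix_def by (simp add: if_distrib if_distribR cong: if_cong)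

definition spectral_matrix :: "complex ^ 'n ^ 'n \<Rightarrow> ('n \<Rightarrow> complex) \<Rightarrow> complex ^ 'n ^ 'n"
  where "spectral_matrix S a = S ** diag_matrix (\<chi> j. a j) ** matrix_inv S"

lemma diagonalizes_iff:
  "diagonalizes S L T \<longleftrightarrow> invertible S \<and> (\<forall>i. T i = spectral_matrix S (\<lambda>j. L $ j $ i))"
  unfolding diagonalizes_def spectral_matrix_def ..

lemma spectral_matrix_intertwine:
  assumes "invertible S" "invertible S'"
  shows "spectral_matrix S a = spectral_matrix S' b \<longleftrightarrow>
    (\<forall>j k. (matrix_inv S' ** S) $ j $ k * a k = b j * (matrix_inv S' ** S) $ j $ k)"
proof -
  note inv = matrix_inverse[OF assms(1)] matrix_inverse[OF assms(2)]
  let ?M = "matrix_inv S' ** S" and ?a = "diag_matrix (\<chi> j. a j)" and ?b = "diag_matrix (\<chi> j. b j)"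
  have "spectral_matrix S a = spectral_matrix S' b \<longleftrightarrow> ?M ** ?a = ?b ** ?M"
  proof
    assume "spectral_matrix S a = spectral_matrix S' b"
    then have "matrix_inv S' ** (S ** ?a ** matrix_inv S) ** S = matrix_inv S' ** (S' ** ?b ** matrix_inv S') ** S"
      unfolding spectral_matrix_def by simp
    moreover have "matrix_inv S' ** (S ** ?a ** matrix_inv S) ** S = ?M ** ?a ** (matrix_inv S ** S)"
      by (simp only: matrix_mul_assoc)
    moreover have "matrix_inv S' ** (S' ** ?b ** matrix_inv S') ** S = (matrix_inv S' ** S') ** ?b ** ?M"
      by (simp only: matrix_mul_assoc)
    ultimately show "?M ** ?a = ?b ** ?M" by (simp add: inv)
  next
    assume eq: "?M ** ?a = ?b ** ?M"
    have "S ** ?a ** matrix_inv S = (S' ** matrix_inv S') ** S ** ?a ** matrix_inv S"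
      by (simp add: inv)
    also have "\<dots> = S' ** (?M ** ?a) ** matrix_inv S"
      by (simp only: matrix_mul_assoc)
    also have "\<dots> = S' ** ?b ** matrix_inv S' ** (S ** matrix_inv S)"
      unfolding eq by (simp only: matrix_mul_assoc)
    finally show "spectral_matrix S a = spectral_matrix S' b"
      unfolding spectral_matrix_def by (simp add: inv)
  qed
  also have "\<dots> \<longleftrightarrow> (\<forall>j k. ?M $ j $ k * a k = b j * ?M $ j $ k)"
    by (simp add: vec_eq_iff matrix_mult_diag_entry diag_mult_matrix_entry)
  finally show ?thesis .
qed

text \<open>Two diagonalizations of \<open>T\<close> are related by \<open>M = matrix_inv S ** S'\<close>, and \<open>M $ j $ k \<noteq> 0\<close> forces the
  joint eigenvalues \<open>L $ j\<close> and \<open>L' $ k\<close> to be the same point.  Hence \<open>M\<close> also intertwines the values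
  of \<open>f\<close>, and the description in the definition of \<open>apply_tuple\<close> is unambiguous.\<close>

lemma apply_tuple_diagonalizes:
  assumes "diagonalizes S L T"
  shows "apply_tuple f T = spectral_matrix S (\<lambda>j. f (L $ j))"
proof -
  have uniq: "spectral_matrix S' (\<lambda>j. f (L' $ j)) = spectral_matrix S (\<lambda>j. f (L $ j))"
    if "diagonalizes S' L' T" for S' L'
  proof -
    let ?M = "matrix_inv S ** S'"
    have inv: "invertible S'" "invertible S" using assms that unfolding diagonalizes_iff by auto
    have "spectral_matrix S' (\<lambda>j. L' $ j $ i) = spectral_matrix S (\<lambda>j. L $ j $ i)" for i
      using assms that unfolding diagonalizes_iff by metis
    then have *: "?M $ j $ k * L' $ k $ i = L $ j $ i * ?M $ j $ k" for i j k
      using spectral_matrix_intertwine[OF inv, of "\<lambda>j. L' $ j $ i" "\<lambda>j. L $ j $ i"] by simp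
    have "?M $ j $ k * f (L' $ k) = f (L $ j) * ?M $ j $ k" for j k
    proof (cases "?M $ j $ k = 0")
      case False
      then have "L' $ k = L $ j" using *[of j k] by (simp add: vec_eq_iff mult.commute)
      then show ?thesis by simp
    qed simp
    then show ?thesis unfolding spectral_matrix_intertwine[OF inv] by blast
  qed
  show ?thesis
    unfolding apply_tuple_def spectral_matrix_def[symmetric]
    using assms uniq by (intro the_equality) blast+
qed

lemma spectral_matrix_commute:
  assumes "invertible S"
  shows "spectral_matrix S a ** spectral_matrix S b = spectral_matrix S b ** spectral_matrix S a"
proof -
  have "spectral_matrix S a ** spectral_matrix S b = S ** (diag_matrix (\<chi> j. a j) ** diag_matrix (\<chi> j. b j)) ** matrix_inv S" for a b
  proof -
    have "spectral_matrix S a ** spectral_matrix S b =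
        S ** diag_matrix (\<chi> j. a j) ** (matrix_inv S ** S) ** diag_matrix (\<chi> j. b j) ** matrix_inv S"
      unfolding spectral_matrix_def by (simp only: matrix_mul_assoc)
    then show ?thesis by (simp add: matrix_inverse[OF assms] matrix_mul_assoc)
  qed
  moreover have "diag_matrix (\<chi> j. a j) ** diag_matrix (\<chi> j. b j) = diag_matrix (\<chi> j. b j) ** diag_matrix (\<chi> j. a j)"
    by (simp add: vec_eq_iff matrix_mult_diag_entry) (simp add: diag_matrix_def)
  ultimately show ?thesis by metis
qed

text \<open>The columns of \<open>conj_transpose (matrix_inv S)\<close> are the joint eigenvectors of the adjoints of all
  matrices \<open>spectral_matrix S a\<close>; this is their Gram matrix.\<close>

definition eigenvector_gram :: "complex ^ 'n ^ 'n \<Rightarrow> 'n \<Rightarrow> 'n \<Rightarrow> complex"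
  where "eigenvector_gram S j k =
    (\<Sum>l\<in>UNIV. cnj (conj_transpose (matrix_inv S) $ l $ j) * conj_transpose (matrix_inv S) $ l $ k)"

lemma quadratic_form_gram:
  "quadratic_form UNIV (eigenvector_gram S) (\<lambda>j. c $ j) =
    of_real ((norm (conj_transpose (matrix_inv S) *v c))\<^sup>2)"
proof -
  define V where "V = conj_transpose (matrix_inv S)"
  have "quadratic_form UNIV (eigenvector_gram S) (\<lambda>j. c $ j) =
      (\<Sum>j\<in>UNIV. \<Sum>k\<in>UNIV. \<Sum>l\<in>UNIV. cnj (V $ l $ j * c $ j) * (V $ l $ k * c $ k))"
    unfolding quadratic_form_def eigenvector_gram_def V_def[symmetric]
    by (intro sum.cong refl) (simp add: sum_distrib_left sum_distrib_right mult_ac)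
  also have "\<dots> = (\<Sum>j\<in>UNIV. \<Sum>l\<in>UNIV. \<Sum>k\<in>UNIV. cnj (V $ l $ j * c $ j) * (V $ l $ k * c $ k))"
    by (rule sum.cong[OF refl], rule sum.swap)
  also have "\<dots> = (\<Sum>l\<in>UNIV. \<Sum>j\<in>UNIV. \<Sum>k\<in>UNIV. cnj (V $ l $ j * c $ j) * (V $ l $ k * c $ k))"
    by (rule sum.swap)
  also have "\<dots> = (\<Sum>l\<in>UNIV. cnj ((V *v c) $ l) * (V *v c) $ l)"
    by (simp add: matrix_vector_mult_def sum_product)
  also have "\<dots> = of_real (\<Sum>l\<in>UNIV. (cmod ((V *v c) $ l))\<^sup>2)"
    unfolding of_real_sum complex_norm_square by (simp add: mult.commute)
  also have "\<dots> = of_real ((norm (V *v c))\<^sup>2)"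
    unfolding norm_vec_def L2_set_def by (simp add: sum_nonneg)
  finally show ?thesis unfolding V_def .
qed

lemma eigenvector_gram_commute: "eigenvector_gram S k j = cnj (eigenvector_gram S j k)"
  unfolding eigenvector_gram_def by (simp add: mult.commute)

lemma conj_transpose_inverse:
  assumes "invertible S"
  shows "conj_transpose S ** conj_transpose (matrix_inv S) = mat 1"
    "conj_transpose (matrix_inv S) ** conj_transpose S = mat 1"
  unfolding conj_transpose_mult[symmetric] matrix_inverse[OF assms] by simp_all

lemma positive_definite_gram:
  assumes "invertible S"
  shows "positive_definite UNIV (eigenvector_gram S)"
proof -
  have form: "Re (quadratic_form UNIV (eigenvector_gram S) c) = (norm (conj_transpose (matrix_inv S) *v (\<chi> j. c j)))\<^sup>2" for c
    using quadratic_form_gram[of S "\<chi> j. c j"] by simp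
  have "c j = 0" if "conj_transpose (matrix_inv S) *v (\<chi> j. c j) = 0" for c j
  proof -
    have "(\<chi> j. c j) = (conj_transpose S ** conj_transpose (matrix_inv S)) *v (\<chi> j. c j)"
      by (simp add: conj_transpose_inverse[OF assms])
    also have "\<dots> = 0" using that by (simp add: matrix_vector_mul_assoc[symmetric])
    finally show ?thesis by (simp add: vec_eq_iff)
  qed
  then show ?thesis
    unfolding positive_definite_def psd_def form
    by (intro conjI ballI allI impI eigenvector_gram_commute) auto
qed

lemma adjoint_spectral_matrix_apply:
  assumes "invertible S"
  shows "conj_transpose (spectral_matrix S a) *v (conj_transpose (matrix_inv S) *v c) =
    conj_transpose (matrix_inv S) *v (\<chi> j. cnj (a j) * c $ j)"
proof -
  have "conj_transpose (spectral_matrix S a) ** conj_transpose (matrix_inv S) =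
      conj_transpose (matrix_inv S) ** diag_matrix (\<chi> j. cnj (a j)) ** (conj_transpose S ** conj_transpose (matrix_inv S))"
    unfolding spectral_matrix_def conj_transpose_mult conj_transpose_diag_matrix
    by (simp add: matrix_mul_assoc)
  also have "\<dots> = conj_transpose (matrix_inv S) ** diag_matrix (\<chi> j. cnj (a j))"
    by (simp add: conj_transpose_inverse[OF assms])
  finally have "conj_transpose (spectral_matrix S a) *v (conj_transpose (matrix_inv S) *v c) =
      conj_transpose (matrix_inv S) *v (diag_matrix (\<chi> j. cnj (a j)) *v c)"
    by (simp add: matrix_vector_mul_assoc)
  moreover have "diag_matrix (\<chi> j. cnj (a j)) *v c = (\<chi> j. cnj (a j) * c $ j)"
    unfolding diag_matrix_def matrix_vector_mult_def
    by (simp add: vec_eq_iff if_distrib if_distribR cong: if_cong)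
  ultimately show ?thesis by simp
qed

text \<open>Every vector is a combination of the joint eigenvectors of the adjoints.  In terms of its coefficients
  both sides of the inequality are forms built from the Gram matrix.\<close>

lemma spectral_row_bound_iff_psd:
  assumes "invertible S" "finite I"
  shows "(\<forall>x. (\<Sum>i\<in>I. (norm (conj_transpose (spectral_matrix S (a i)) *v x))\<^sup>2) \<le> C\<^sup>2 * (norm x)\<^sup>2) \<longleftrightarrow>
    psd UNIV (\<lambda>j k. (of_real (C\<^sup>2) - (\<Sum>i\<in>I. a i j * cnj (a i k))) * eigenvector_gram S j k)"
proof -
  let ?V = "conj_transpose (matrix_inv S)" and ?G = "eigenvector_gram S"
  let ?P = "\<lambda>j k. (of_real (C\<^sup>2) - (\<Sum>i\<in>I. a i j * cnj (a i k))) * ?G j k"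
  have surj: "?V *v (conj_transpose S *v x) = x" for x
    by (simp add: matrix_vector_mul_assoc conj_transpose_inverse[OF assms(1)])
  have part: "quadratic_form UNIV (\<lambda>j k. (\<Sum>i\<in>I. a i j * cnj (a i k)) * ?G j k) c =
      (\<Sum>i\<in>I. quadratic_form UNIV ?G (\<lambda>j. cnj (a i j) * c j))" for c
  proof -
    have "quadratic_form UNIV (\<lambda>j k. (\<Sum>i\<in>I. a i j * cnj (a i k)) * ?G j k) c =
        (\<Sum>j\<in>UNIV. \<Sum>k\<in>UNIV. \<Sum>i\<in>I. cnj (cnj (a i j) * c j) * ?G j k * (cnj (a i k) * c k))"
      unfolding quadratic_form_def
      by (intro sum.cong refl) (simp add: sum_distrib_left sum_distrib_right mult_ac)
    also have "\<dots> = (\<Sum>j\<in>UNIV. \<Sum>i\<in>I. \<Sum>k\<in>UNIV. cnj (cnj (a i j) * c j) * ?G j k * (cnj (a i k) * c k))"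
      by (rule sum.cong[OF refl], rule sum.swap)
    also have "\<dots> = (\<Sum>i\<in>I. quadratic_form UNIV ?G (\<lambda>j. cnj (a i j) * c j))"
      unfolding quadratic_form_def by (rule sum.swap)
    finally show ?thesis .
  qed
  have form: "Re (quadratic_form UNIV ?P (\<lambda>j. c $ j)) = C\<^sup>2 * (norm (?V *v c))\<^sup>2 -
      (\<Sum>i\<in>I. (norm (conj_transpose (spectral_matrix S (a i)) *v (?V *v c)))\<^sup>2)" for c
  proof -
    have "quadratic_form UNIV ?P (\<lambda>j. c $ j) = quadratic_form UNIV
        (\<lambda>j k. of_real (C\<^sup>2) * ?G j k + (- 1) * ((\<Sum>i\<in>I. a i j * cnj (a i k)) * ?G j k)) (\<lambda>j. c $ j)"
      by (intro quadratic_form_cong) (auto simp: algebra_simps)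
    also have "\<dots> = of_real (C\<^sup>2) * quadratic_form UNIV ?G (\<lambda>j. c $ j)
        - (\<Sum>i\<in>I. quadratic_form UNIV ?G (\<lambda>j. (\<chi> j. cnj (a i j) * c $ j) $ j))"
      unfolding quadratic_form_linear part by simp
    also have "\<dots> = of_real (C\<^sup>2 * (norm (?V *v c))\<^sup>2 -
        (\<Sum>i\<in>I. (norm (conj_transpose (spectral_matrix S (a i)) *v (?V *v c)))\<^sup>2))"
      unfolding quadratic_form_gram adjoint_spectral_matrix_apply[OF assms(1)] by simp
    finally show ?thesis by (simp only: Re_complex_of_real)
  qed
  let ?N = "\<lambda>x. \<Sum>i\<in>I. (norm (conj_transpose (spectral_matrix S (a i)) *v x))\<^sup>2"
  have herm: "?P k j = cnj (?P j k)" for j k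
    by (simp add: eigenvector_gram_commute[of S k j] mult.commute)
  show ?thesis
  proof
    assume *: "\<forall>x. ?N x \<le> C\<^sup>2 * (norm x)\<^sup>2"
    have "0 \<le> Re (quadratic_form UNIV ?P c)" for c
    proof -
      have "0 \<le> Re (quadratic_form UNIV ?P (\<lambda>j. (\<chi> j. c j) $ j))"
        unfolding form diff_ge_0_iff_ge using * by (rule spec)
      then show ?thesis by simp
    qed
    then show "psd UNIV ?P" unfolding psd_def using herm by blast
  next
    assume psd: "psd UNIV ?P"
    show "\<forall>x. ?N x \<le> C\<^sup>2 * (norm x)\<^sup>2"
    proof
      fix x
      have "0 \<le> Re (quadratic_form UNIV ?P (\<lambda>j. (conj_transpose S *v x) $ j))"
        by (rule psd_nonneg[OF psd])
      also have "\<dots> = C\<^sup>2 * (norm x)\<^sup>2 - ?N x"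
        unfolding form surj ..
      finally show "?N x \<le> C\<^sup>2 * (norm x)\<^sup>2"
        by (simp only: diff_ge_0_iff_ge)
    qed
  qed
qed

lemma op_norm_spectral_le_iff:
  assumes S: "invertible S" and C: "0 \<le> C"
  shows "op_norm (spectral_matrix S a) \<le> C \<longleftrightarrow>
    psd UNIV (\<lambda>j k. (of_real (C\<^sup>2) - a j * cnj (a k)) * eigenvector_gram S j k)"
proof -
  have singleton: "sum h {()} = h ()" for h :: "unit \<Rightarrow> 'x :: comm_monoid_add"
    by simp
  show ?thesis
    using spectral_row_bound_iff_psd[OF S, of "{()}" "\<lambda>_. a" C, OF finite]
    unfolding op_norm_le_iff_adjoint[OF C, of "spectral_matrix S a"] singleton .
qed

lemma row_contraction_spectral_iff:
  fixes S :: "complex ^ 'n ^ 'n" and L :: "complex ^ 'd ^ 'n"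
  assumes "invertible S"
  shows "(\<lambda>i. spectral_matrix S (\<lambda>j. L $ j $ i)) \<in> commuting_row_contractions \<longleftrightarrow>
    psd UNIV (\<lambda>j k. (1 - hermitian_inner (L $ j) (L $ k)) * eigenvector_gram S j k)"
  using spectral_row_bound_iff_psd[OF assms, of UNIV "\<lambda>i j. L $ j $ i" 1] spectral_matrix_commute[OF assms]
  unfolding commuting_row_contractions_def row_contraction_iff mem_Collect_eq hermitian_inner_def by simp

section \<open>Comparison of the two suprema\<close>

text \<open>The diagonal entries of the two forms differ by the factor \<open>1 - (norm (L $ j))\<^sup>2\<close>, and those of the
  Gram matrix are positive.\<close>

lemma row_contraction_joint_eigenvalue_norm:
  assumes S: "invertible S"
    and contr: "psd UNIV (\<lambda>j k. (1 - hermitian_inner (L $ j) (L $ k)) * eigenvector_gram S j k)"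
  shows "norm (L $ j) \<le> 1"
proof -
  have pd: "positive_definite UNIV (eigenvector_gram S)" by (rule positive_definite_gram[OF S])
  have "0 \<le> Re (eigenvector_gram S j j)"
    using pd unfolding positive_definite_def by (intro psd_diagonal_nonneg) auto
  moreover have "Re (eigenvector_gram S j j) \<noteq> 0"
  proof
    assume "Re (eigenvector_gram S j j) = 0"
    moreover have "quadratic_form UNIV (eigenvector_gram S) (\<lambda>k. if k = j then 1 else 0) =
        quadratic_form {j} (eigenvector_gram S) (\<lambda>k. if k = j then 1 else 0)"
      by (intro quadratic_form_mono_neutral) auto
    ultimately have "Re (quadratic_form UNIV (eigenvector_gram S) (\<lambda>k. if k = j then 1 else 0)) = 0"
      by (simp add: quadratic_form_def)
    from positive_definite_null[OF pd this, of j] show False by simp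
  qed
  ultimately have G: "Re (eigenvector_gram S j j) > 0" by simp
  have "0 \<le> Re ((1 - hermitian_inner (L $ j) (L $ j)) * eigenvector_gram S j j)"
    by (rule psd_diagonal_nonneg[OF contr]) auto
  then have "0 \<le> (1 - (norm (L $ j))\<^sup>2) * Re (eigenvector_gram S j j)"
    unfolding hermitian_inner_self by (simp del: of_real_power)
  then have "(norm (L $ j))\<^sup>2 \<le> 1" using G by (simp add: zero_le_mult_iff)
  then show ?thesis by (simp add: power_le_one_iff abs_square_le_1)
qed

text \<open>Schur's product theorem for the row contraction form of \<open>T\<close> and the multiplier form of \<open>f\<close>, where
  the kernel cancels against \<open>1 - hermitian_inner z w\<close>.  The points \<open>L $ j\<close> need not be distinct and
  may lie on the sphere, hence the pullback along \<open>j\<close> and the dilation by \<open>r < 1\<close>.\<close>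

lemma norm_apply_tuple_le_mult_norm_points:
  fixes f :: "complex ^ 'd \<Rightarrow> complex" and T :: "'d \<Rightarrow> complex ^ 'n ^ 'n"
  assumes cont: "\<And>z. norm z \<le> 1 \<Longrightarrow> isCont f z"
    and T: "T \<in> commuting_row_contractions" "jointly_diagonalizable T"
    and C: "0 \<le> C" "mult_norm_points (ball 0 1) drury_arveson_kernel CARD('n) f \<le> ereal C"
  shows "op_norm (apply_tuple f T) \<le> C"
proof -
  obtain S L where diag: "diagonalizes S L T" using T(2) unfolding jointly_diagonalizable_def by blast
  have S: "invertible S" and "T = (\<lambda>i. spectral_matrix S (\<lambda>j. L $ j $ i))"
    using diag unfolding diagonalizes_iff by auto
  let ?G = "eigenvector_gram S"
  have contr: "psd UNIV (\<lambda>j k. (1 - hermitian_inner (L $ j) (L $ k)) * ?G j k)"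
    using T(1) unfolding \<open>T = _\<close> row_contraction_spectral_iff[OF S] .
  have G: "psd UNIV ?G" using positive_definite_gram[OF S] unfolding positive_definite_def by blast
  note L1 = row_contraction_joint_eigenvalue_norm[OF S contr]
  have scaled: "psd UNIV (\<lambda>j k. (of_real (C\<^sup>2) - f (r *\<^sub>R L $ j) * cnj (f (r *\<^sub>R L $ k))) * ?G j k)"
    if r: "0 \<le> r" "r < 1" for r
  proof -
    let ?K = "\<lambda>j k. drury_arveson_kernel (r *\<^sub>R L $ j) (r *\<^sub>R L $ k)"
    let ?F = "(\<lambda>j. r *\<^sub>R L $ j) ` UNIV"
    have ball: "r *\<^sub>R L $ j \<in> ball 0 1" for j
      using L1[of j] r mult_left_mono[of "norm (L $ j)" 1 r] by simp
    have F: "?F \<subseteq> ball 0 1" "finite ?F" "card ?F \<le> CARD('n)"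
      using ball card_image_le[of "UNIV :: 'n set"] by auto
    then have "mult_norm ?F drury_arveson_kernel f \<le> mult_norm_points (ball 0 1) drury_arveson_kernel CARD('n) f"
      unfolding mult_norm_points_def by (intro SUP_upper) (simp only: mem_Collect_eq simp_thms)
    then have "mult_norm ?F drury_arveson_kernel f \<le> ereal C"
      using C(2) by (rule order_trans)
    then have "psd ?F (\<lambda>z w. (of_real (C\<^sup>2) - f z * cnj (f w)) * drury_arveson_kernel z w)"
      unfolding mult_norm_finite_le_iff[OF F(2) positive_definite_drury_arveson_kernel[OF F(2,1)] C(1)] .
    then have B: "psd UNIV (\<lambda>j k. (of_real (C\<^sup>2) - f (r *\<^sub>R L $ j) * cnj (f (r *\<^sub>R L $ k))) * ?K j k)"
      by (rule psd_pullback) simp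
    \<comment> \<open>Scaling the points by \<open>r\<close> preserves the contraction form, because
      \<open>1 - r\<^sup>2 t = r\<^sup>2 (1 - t) + (1 - r\<^sup>2)\<close>.\<close>
    have "psd UNIV (\<lambda>j k. of_real (r\<^sup>2) * ((1 - hermitian_inner (L $ j) (L $ k)) * ?G j k) + of_real (1 - r\<^sup>2) * ?G j k)"
      using r by (intro psd_add_scale contr G) (auto simp: power_le_one)
    moreover have "of_real (r\<^sup>2) * ((1 - hermitian_inner (L $ j) (L $ k)) * ?G j k) + of_real (1 - r\<^sup>2) * ?G j k
        = (1 - hermitian_inner (r *\<^sub>R L $ j) (r *\<^sub>R L $ k)) * ?G j k" for j k
    proof -
      have "hermitian_inner (r *\<^sub>R L $ j) (r *\<^sub>R L $ k) = of_real (r\<^sup>2) * hermitian_inner (L $ j) (L $ k)"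
        unfolding hermitian_inner_def vector_scaleR_component
        by (simp add: sum_distrib_left power2_eq_square scaleR_conv_of_real mult_ac)
      then show ?thesis by (simp add: algebra_simps)
    qed
    ultimately have "psd UNIV (\<lambda>j k. (1 - hermitian_inner (r *\<^sub>R L $ j) (r *\<^sub>R L $ k)) * ?G j k)"
      by (simp only:)
    from psd_schur_product[OF finite this B]
    have "psd UNIV (\<lambda>j k. (1 - hermitian_inner (r *\<^sub>R L $ j) (r *\<^sub>R L $ k)) * ?G j k *
      ((of_real (C\<^sup>2) - f (r *\<^sub>R L $ j) * cnj (f (r *\<^sub>R L $ k))) * ?K j k))" .
    moreover have "(1 - hermitian_inner (r *\<^sub>R L $ j) (r *\<^sub>R L $ k)) * ?G j k *
      ((of_real (C\<^sup>2) - f (r *\<^sub>R L $ j) * cnj (f (r *\<^sub>R L $ k))) * ?K j k)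
      = (of_real (C\<^sup>2) - f (r *\<^sub>R L $ j) * cnj (f (r *\<^sub>R L $ k))) * ?G j k" for j k
    proof -
      have "(1 - hermitian_inner (r *\<^sub>R L $ j) (r *\<^sub>R L $ k)) * ?G j k *
        ((of_real (C\<^sup>2) - f (r *\<^sub>R L $ j) * cnj (f (r *\<^sub>R L $ k))) * ?K j k)
        = ((1 - hermitian_inner (r *\<^sub>R L $ j) (r *\<^sub>R L $ k)) * ?K j k) *
          ((of_real (C\<^sup>2) - f (r *\<^sub>R L $ j) * cnj (f (r *\<^sub>R L $ k))) * ?G j k)"
        by (simp only: mult_ac)
      then show ?thesis unfolding drury_arveson_kernel_inverse[OF ball ball] by simp
    qed
    ultimately show ?thesis by (simp only:)
  qed
  have "psd UNIV (\<lambda>j k. (of_real (C\<^sup>2) - f (L $ j) * cnj (f (L $ k))) * ?G j k)"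
  proof -
    \<comment> \<open>Any sequence in \<open>[0, 1)\<close> with limit \<open>1\<close> would do.\<close>
    define r where "r = (\<lambda>m. real m / real (Suc m))"
    have r: "0 \<le> r m" "r m < 1" for m unfolding r_def by auto
    have "r \<longlonglongrightarrow> 1" unfolding r_def by (rule LIMSEQ_n_over_Suc_n)
    then have "(\<lambda>m. r m *\<^sub>R L $ j) \<longlonglongrightarrow> 1 *\<^sub>R L $ j" for j by (intro tendsto_intros)
    then have lim: "(\<lambda>m. f (r m *\<^sub>R L $ j)) \<longlonglongrightarrow> f (L $ j)" for j
      by (intro isCont_tendsto_compose[OF cont[OF L1]]) simp
    have "0 \<le> Re (quadratic_form UNIV (\<lambda>j k. (of_real (C\<^sup>2) - f (L $ j) * cnj (f (L $ k))) * ?G j k) c)" for c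
    proof (rule LIMSEQ_le_const)
      show "(\<lambda>m. Re (quadratic_form UNIV (\<lambda>j k. (of_real (C\<^sup>2) - f (r m *\<^sub>R L $ j) * cnj (f (r m *\<^sub>R L $ k))) * ?G j k) c))
        \<longlonglongrightarrow> Re (quadratic_form UNIV (\<lambda>j k. (of_real (C\<^sup>2) - f (L $ j) * cnj (f (L $ k))) * ?G j k) c)"
        unfolding quadratic_form_def by (intro tendsto_intros lim)
      show "\<exists>N. \<forall>m\<ge>N. 0 \<le> Re (quadratic_form UNIV (\<lambda>j k. (of_real (C\<^sup>2) - f (r m *\<^sub>R L $ j) * cnj (f (r m *\<^sub>R L $ k))) * ?G j k) c)"
        using psd_nonneg[OF scaled[OF r]] by blast
    qed
    moreover have "(of_real (C\<^sup>2) - f (L $ k) * cnj (f (L $ j))) * ?G k j =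
        cnj ((of_real (C\<^sup>2) - f (L $ j) * cnj (f (L $ k))) * ?G j k)" for j k
      by (simp add: eigenvector_gram_commute[of S k j] mult.commute)
    ultimately show ?thesis unfolding psd_def by blast
  qed
  then show ?thesis
    unfolding apply_tuple_diagonalizes[OF diag] using op_norm_spectral_le_iff[OF S C(1)] by blast
qed

text \<open>A Cholesky factor \<open>W\<close> of \<open>P\<close> is invertible since \<open>P\<close> has no null vectors; its columns become the
  joint eigenvectors of the adjoints when \<open>S\<close> is the conjugate transpose of the inverse of \<open>W\<close>.\<close>

lemma positive_definite_eq_gram:
  assumes "positive_definite UNIV P"
  obtains S :: "complex ^ 'n ^ 'n" where "invertible S" "eigenvector_gram S = P"
proof -
  have psd: "psd UNIV P" using assms unfolding positive_definite_def by blast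
  obtain V where "\<forall>j\<in>UNIV. \<forall>k\<in>UNIV. P j k = (\<Sum>l\<in>(UNIV :: 'n set). cnj (V l j) * V l k)"
    using psd_factorization[OF finite psd] by blast
  then have V: "P j k = (\<Sum>l\<in>UNIV. cnj (V l j) * V l k)" for j k by simp
  define W where "W = (\<chi> l j. V l j)"
  define S where "S = conj_transpose (matrix_inv W)"
  have "c = 0" if "W *v c = 0" for c
  proof -
    have "quadratic_form UNIV P (\<lambda>j. c $ j) = (\<Sum>j\<in>UNIV. \<Sum>k\<in>UNIV. \<Sum>l\<in>UNIV. cnj (c $ j * V l j) * (V l k * c $ k))"
      unfolding quadratic_form_def V
      by (intro sum.cong refl) (simp add: sum_distrib_left sum_distrib_right mult_ac)
    also have "\<dots> = (\<Sum>j\<in>UNIV. \<Sum>l\<in>UNIV. \<Sum>k\<in>UNIV. cnj (c $ j * V l j) * (V l k * c $ k))"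
      by (rule sum.cong[OF refl], rule sum.swap)
    also have "\<dots> = (\<Sum>j\<in>UNIV. \<Sum>l\<in>UNIV. cnj (c $ j * V l j) * (W *v c) $ l)"
      by (intro sum.cong refl) (simp only: W_def matrix_vector_mult_def vec_lambda_beta sum_distrib_left)
    also have "\<dots> = 0" unfolding that by simp
    finally have "Re (quadratic_form UNIV P (\<lambda>j. c $ j)) = 0" by simp
    from positive_definite_null[OF assms this] show ?thesis by (simp add: vec_eq_iff)
  qed
  then have W: "invertible W"
    unfolding invertible_left_inverse matrix_left_invertible_ker by blast
  have 1: "S ** conj_transpose W = mat 1" "conj_transpose W ** S = mat 1"
    unfolding S_def by (rule conj_transpose_inverse[OF W])+
  then have S: "invertible S" unfolding invertible_def by blast
  have "matrix_inv S = (matrix_inv S ** S) ** conj_transpose W"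
    by (simp only: 1 matrix_mul_assoc[symmetric] matrix_mul_rid)
  then have "matrix_inv S = conj_transpose W"
    by (simp add: matrix_inverse[OF S])
  then have "eigenvector_gram S = P"
    by (intro ext) (simp add: eigenvector_gram_def V W_def)
  then show ?thesis using S that by blast
qed

text \<open>The tuple \<open>T\<close> is unitarily equivalent to the coordinate multiplications on the space over \<open>n\<close> points
  containing \<open>F\<close>: its Gram matrix is the kernel matrix of these points.\<close>

lemma mult_norm_finite_le_norm_apply_tuple:
  fixes f :: "complex ^ 'd \<Rightarrow> complex" and F :: "(complex ^ 'd) set"
  assumes F: "F \<subseteq> ball 0 1" "finite F" "card F \<le> CARD('n)"
  shows "\<exists>T \<in> (commuting_row_contractions :: ('d \<Rightarrow> complex ^ 'n ^ 'n) set).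
    jointly_diagonalizable T \<and> mult_norm F drury_arveson_kernel f \<le> ereal (op_norm (apply_tuple f T))"
proof -
  have "infinite (ball (0 :: complex ^ 'd) 1)"
    using uncountable_ball[of 1 "0 :: complex ^ 'd"] countable_finite by auto
  then obtain B where B: "finite B" "card B = CARD('n)" "B \<subseteq> ball (0 :: complex ^ 'd) 1"
    using infinite_arbitrarily_large by blast
  have "CARD('n) \<le> card (F \<union> B)"
    unfolding B(2)[symmetric] using F B by (intro card_mono) auto
  then obtain A where A: "F \<subseteq> A" "A \<subseteq> F \<union> B" "card A = CARD('n)"
    using exists_subset_between[of F "CARD('n)" "F \<union> B"] F B by auto
  have A1: "finite A" "A \<subseteq> ball 0 1" using A F B finite_subset[OF A(2)] by auto
  obtain p where p: "bij_betw p (UNIV :: 'n set) A"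
    using finite_same_card_bij[of "UNIV :: 'n set" A] A1 A by auto
  have inj: "inj p" and range: "range p = A" using p unfolding bij_betw_def by auto
  have ball: "p j \<in> ball 0 1" for j using range A1(2) by blast
  let ?K = "\<lambda>j k. drury_arveson_kernel (p j) (p k)"
  have pdA: "positive_definite (range p) drury_arveson_kernel"
    unfolding range by (rule positive_definite_drury_arveson_kernel[OF A1])
  have "positive_definite UNIV ?K"
    by (rule positive_definite_pullback[OF pdA finite inj])
  then obtain S :: "complex ^ 'n ^ 'n" where S: "invertible S" "eigenvector_gram S = ?K"
    by (rule positive_definite_eq_gram)
  define L :: "complex ^ 'd ^ 'n" where "L = (\<chi> j. p j)"
  define T where "T = (\<lambda>i. spectral_matrix S (\<lambda>j. L $ j $ i))"
  have diag: "diagonalizes S L T"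
    unfolding diagonalizes_iff T_def using S by simp
  have "psd UNIV (\<lambda>j k. (1 - hermitian_inner (L $ j) (L $ k)) * eigenvector_gram S j k)"
  proof -
    have one: "(1 - hermitian_inner (L $ j) (L $ k)) * eigenvector_gram S j k = 1" for j k
      unfolding S(2) L_def using drury_arveson_kernel_inverse[OF ball ball] by simp
    show ?thesis unfolding one unfolding psd_def by (simp add: quadratic_form_one)
  qed
  then have T: "T \<in> commuting_row_contractions"
    unfolding T_def row_contraction_spectral_iff[OF S(1)] .
  define C where "C = op_norm (apply_tuple f T)"
  have C: "0 \<le> C" unfolding C_def op_norm_def by (intro onorm_pos_le) auto
  have "op_norm (spectral_matrix S (\<lambda>j. f (L $ j))) \<le> C"
    unfolding C_def apply_tuple_diagonalizes[OF diag] by simp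
  then have "psd UNIV (\<lambda>j k. (of_real (C\<^sup>2) - f (p j) * cnj (f (p k))) * drury_arveson_kernel (p j) (p k))"
    unfolding op_norm_spectral_le_iff[OF S(1) C] S(2) L_def by simp
  then have "psd (range p) (\<lambda>z w. (of_real (C\<^sup>2) - f z * cnj (f w)) * drury_arveson_kernel z w)"
    using inj by (rule psd_image)
  then have "psd F (\<lambda>z w. (of_real (C\<^sup>2) - f z * cnj (f w)) * drury_arveson_kernel z w)"
    by (rule psd_subset) (use A(1) A1(1) range in simp_all)
  then have "mult_norm F drury_arveson_kernel f \<le> ereal C"
    unfolding mult_norm_finite_le_iff[OF F(2) positive_definite_drury_arveson_kernel[OF F(2,1)] C] .
  then show ?thesis using T diag unfolding C_def jointly_diagonalizable_def by blast
qed

theorem proposition3p1: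
  fixes f :: "complex ^ 'd \<Rightarrow> complex" and U :: "(complex ^ 'd) set"
  assumes "open U" and "cball 0 1 \<subseteq> U" and "holomorphic_several f U"
  shows "mult_norm_points (ball 0 1) drury_arveson_kernel CARD('n) f =
    (SUP T\<in>{T \<in> (commuting_row_contractions :: ('d \<Rightarrow> complex ^ 'n ^ 'n) set).
              jointly_diagonalizable T}. ereal (op_norm (apply_tuple f T)))"
    (is "?M = ?R")
proof (rule antisym)
  show "?M \<le> ?R"
    unfolding mult_norm_points_def
  proof (rule SUP_least)
    fix F :: "(complex ^ 'd) set"
    assume "F \<in> {F. F \<subseteq> ball 0 1 \<and> finite F \<and> card F \<le> CARD('n)}"
    then obtain T :: "'d \<Rightarrow> complex ^ 'n ^ 'n" where
      "T \<in> commuting_row_contractions" "jointly_diagonalizable T"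
      "mult_norm F drury_arveson_kernel f \<le> ereal (op_norm (apply_tuple f T))"
      using mult_norm_finite_le_norm_apply_tuple[of F f, where 'n = 'n] by blast
    then show "mult_norm F drury_arveson_kernel f \<le> ?R"
      by (intro SUP_upper2[of T]) auto
  qed
next
  have cont: "isCont f z" if "norm z \<le> 1" for z
  proof -
    have "z \<in> U" using assms(2) that by auto
    then obtain D where "(f has_derivative D) (at z)"
      using assms(3) unfolding holomorphic_several_def by blast
    then show ?thesis by (rule has_derivative_continuous)
  qed
  \<comment> \<open>The empty set bounds the supremum from below and excludes a negative value.\<close>
  have "0 \<le> mult_norm {} drury_arveson_kernel f"
    by (intro mult_norm_finite_nonneg positive_definite_drury_arveson_kernel) auto
  also have "\<dots> \<le> ?M"
    unfolding mult_norm_points_def by (intro SUP_upper) auto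
  finally have nonneg: "0 \<le> ?M" .
  show "?R \<le> ?M"
  proof (cases ?M)
    case (real C)
    then have "0 \<le> C" using nonneg by simp
    then have "op_norm (apply_tuple f T) \<le> C"
      if "T \<in> commuting_row_contractions" "jointly_diagonalizable T" for T :: "'d \<Rightarrow> complex ^ 'n ^ 'n"
      using norm_apply_tuple_le_mult_norm_points[OF cont that] real by simp
    then show ?thesis unfolding real by (intro SUP_least) auto
  qed (use nonneg in auto)
qed
end
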